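(* Let $n\ge1$, $k\ge1$. The edge labeling of the Hasse diagram of $\mathcal{L}_n^{(k)}$ which assigns to each cover $\pi\lessdot\pi'$ its label $(\alpha,\beta)_l$ (and the label $(1,n)_k$ to each cover $\pi\lessdot\hat1$), with labels totally ordered as in the context, is an $EL$-labeling of $\mathcal{L}_n^{(k)}$.
   Context: Write $[n]=\{1,\dots,n\}$. A weighted partition of $[n]$ with $k$ layers is a $k$-tuple $\pi=(\pi^{(1)},\dots,\pi^{(k)})$ of set partitions of $[n]$ such that $\pi^{(l+1)}$ refines $\pi^{(l)}$ for $1\le l<k$ (equivalently, in the paper's notation, layer $l\ge2$ records the blocks of $\pi^{(l)}$ of size $\ge2$). $\mathcal{P}_n^{(k)}$ is the set of these; rank $\rho(\pi)=n-(\text{number of blocks of }\pi^{(1)})$. Labeled covers: for $\pi\in\mathcal{P}_n^{(k)}$, $1\le\alpha<\beta\le n$, $l\in[k]$, the label $(\alpha,\beta)_l$ is admissible at $\pi$ if $\alpha,\beta$ lie in different blocks $A\ni\alpha$, $B\ni\beta$ of $\pi^{(1)}$, $\beta=\min B$, and $\alpha$ is the smallest element of its block in $\pi^{(l)}$; then $\pi'$ is obtained by replacing, for each $m=1,\dots,l$, the two blocks of $\pi^{(m)}$ containing $\alpha$ and $\beta$ by their union, with $\pi'^{(m)}=\pi^{(m)}$ for $m>l$, and we declare $\pi\lessdot\pi'$ with label $(\alpha,\beta)_l$. The order on $\mathcal{P}_n^{(k)}$ is the reflexive-transitive closure. $\mathcal{L}_n^{(k)}=\mathcal{P}_n^{(k)}\cup\{\hat1\}$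 with additionally $\pi\lessdot\hat1$ labeled $(1,n)_k$ for every $\pi$ of rank $n-1$; $\rho(\hat 1)=n$, and $\hat0$ is the all-singletons element. Total order on labels: $(\alpha_1,\beta_1)_l<(\alpha_2,\beta_2)_{l'}$ iff $l>l'$, or $l=l'$ and $\alpha_1<\alpha_2$, or $l=l'$, $\alpha_1=\alpha_2$ and $\beta_1<\beta_2$. A chain $x_0\lessdot x_1\lessdot\dots\lessdot x_m$ is rising if its labels are weakly increasing. An edge labeling $\lambda$ of a graded poset is an $EL$-labeling if (i) every interval $[x,y]$ contains exactly one rising maximal chain $x=x_0\lessdot x_1\lessdot\dots\lessdot x_m=y$, and (ii) for this chain, whenever $x\lessdot z\le y$ with $z\ne x_1$, one has $\lambda(x,x_1)<\lambda(x,z)$. *)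

theory Defs
  imports Main "HOL-Library.Disjoint_Sets"
begin

subsection \<open>EL-labelings of graded posets\<close>

text \<open>A poset is a carrier \<open>P\<close> with a relation \<open>r \<subseteq> P \<times> P\<close> satisfying \<^const>\<open>partial_order_on\<close>.\<close>

definition hasse_cover :: "'a rel \<Rightarrow> 'a \<Rightarrow> 'a \<Rightarrow> bool" where
  "hasse_cover r x y \<longleftrightarrow> (x, y) \<in> r \<and> x \<noteq> y \<and>
     (\<forall>z. (x, z) \<in> r \<and> (z, y) \<in> r \<longrightarrow> z = x \<or> z = y)"

definition graded_poset :: "'a set \<Rightarrow> 'a rel \<Rightarrow> ('a \<Rightarrow> nat) \<Rightarrow> bool" where
  "graded_poset P r \<rho> \<longleftrightarrow> partial_order_on P r \<and>
     (\<forall>x y. (x, y) \<in> r \<and> x \<noteq> y \<longrightarrow> \<rho> x < \<rho> y) \<and>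
     (\<forall>x y. hasse_cover r x y \<longrightarrow> \<rho> y = \<rho> x + 1) \<and>
     (\<forall>x\<in>P. (\<forall>z. (z, x) \<in> r \<longrightarrow> z = x) \<longrightarrow> \<rho> x = 0)"

text \<open>
  An edge labeling is given by its labeled edges: \<open>E x t y\<close> means that the cover of \<open>x\<close> by \<open>y\<close>
  carries the label \<open>t\<close>. The labeled pairs must be exactly the edges of the Hasse diagram, and
  each edge must carry exactly one label.
\<close>

definition edge_labeling :: "'a rel \<Rightarrow> ('a \<Rightarrow> 'l \<Rightarrow> 'a \<Rightarrow> bool) \<Rightarrow> bool" where
  "edge_labeling r E \<longleftrightarrow>
     (\<forall>x t y. E x t y \<longrightarrow> hasse_cover r x y) \<and>
     (\<forall>x y. hasse_cover r x y \<longrightarrow> (\<exists>!t. E x t y))"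

definition edge_label :: "('a \<Rightarrow> 'l \<Rightarrow> 'a \<Rightarrow> bool) \<Rightarrow> 'a \<Rightarrow> 'a \<Rightarrow> 'l" where
  "edge_label E x y = (THE t. E x t y)"

text \<open>Maximal chains of the interval \<open>[x, y]\<close>, listed from \<open>x\<close> to \<open>y\<close>.\<close>

definition maximal_chain :: "'a rel \<Rightarrow> 'a \<Rightarrow> 'a \<Rightarrow> 'a list \<Rightarrow> bool" where
  "maximal_chain r x y c \<longleftrightarrow> c \<noteq> [] \<and> hd c = x \<and> last c = y \<and> successively (hasse_cover r) c"

definition chain_labels :: "('a \<Rightarrow> 'a \<Rightarrow> 'l) \<Rightarrow> 'a list \<Rightarrow> 'l list" where
  "chain_labels lab c = map2 lab c (tl c)"

definition rising :: "('l \<Rightarrow> 'l \<Rightarrow> bool) \<Rightarrow> ('a \<Rightarrow> 'a \<Rightarrow> 'l) \<Rightarrow> 'a list \<Rightarrow> bool" where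
  "rising lt lab c \<longleftrightarrow> successively (\<lambda>s t. s = t \<or> lt s t) (chain_labels lab c)"

text \<open>
  Below, \<open>lt\<close> is the strict order on the labels. In the last condition \<open>c ! 1\<close> exists, since the
  interval contains a \<open>z\<close> covering \<open>x\<close>.
\<close>

definition EL_labeling ::
  "'a set \<Rightarrow> 'a rel \<Rightarrow> ('a \<Rightarrow> nat) \<Rightarrow> ('l \<Rightarrow> 'l \<Rightarrow> bool) \<Rightarrow> ('a \<Rightarrow> 'l \<Rightarrow> 'a \<Rightarrow> bool) \<Rightarrow> bool" where
  "EL_labeling P r \<rho> lt E \<longleftrightarrow> graded_poset P r \<rho> \<and> edge_labeling r E \<and>
     (\<forall>x y. (x, y) \<in> r \<longrightarrow>
       (\<exists>!c. maximal_chain r x y c \<and> rising lt (edge_label E) c)) \<and>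
     (\<forall>x y c. (x, y) \<in> r \<and> maximal_chain r x y c \<and> rising lt (edge_label E) c \<longrightarrow>
       (\<forall>z. hasse_cover r x z \<and> (z, y) \<in> r \<and> z \<noteq> c ! 1 \<longrightarrow>
          lt (edge_label E x (c ! 1)) (edge_label E x z)))"


subsection \<open>Weighted partitions\<close>

type_synonym wpartition = "nat set set list"

text \<open>Layers are numbered from 1, list positions from 0.\<close>

definition layer :: "wpartition \<Rightarrow> nat \<Rightarrow> nat set set" where
  "layer p l = p ! (l - 1)"

text \<open>\<^term>\<open>refines A P Q\<close> says that \<open>P\<close> is the finer of the two partitions.\<close>

definition weighted_partitions :: "nat \<Rightarrow> nat \<Rightarrow> wpartition set" where
  "weighted_partitions n k = {p. length p = k \<and>
     (\<forall>l\<in>{1..k}. partition_on {1..n} (layer p l)) \<and>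
     (\<forall>l. 1 \<le> l \<and> l < k \<longrightarrow> refines {1..n} (layer p (l + 1)) (layer p l))}"

definition wp_rank :: "nat \<Rightarrow> wpartition \<Rightarrow> nat" where
  "wp_rank n p = n - card (layer p 1)"

definition block :: "nat set set \<Rightarrow> nat \<Rightarrow> nat set" where
  "block Q a = (THE X. X \<in> Q \<and> a \<in> X)"

definition merge_blocks :: "nat \<Rightarrow> nat \<Rightarrow> nat set set \<Rightarrow> nat set set" where
  "merge_blocks a b Q = insert (block Q a \<union> block Q b) (Q - {block Q a, block Q b})"

definition merge_layers :: "nat \<Rightarrow> nat \<Rightarrow> nat \<Rightarrow> wpartition \<Rightarrow> wpartition" where
  "merge_layers a b l p =
     map (\<lambda>m. if m \<le> l then merge_blocks a b (layer p m) else layer p m) [1..<length p + 1]"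

text \<open>The triple \<open>(a, b, l)\<close> stands for the label written \<open>(a, b)\<close> with subscript \<open>l\<close>.\<close>

type_synonym label = "nat \<times> nat \<times> nat"

definition admissible :: "nat \<Rightarrow> nat \<Rightarrow> wpartition \<Rightarrow> label \<Rightarrow> bool" where
  "admissible n k p = (\<lambda>(a, b, l).
     1 \<le> a \<and> a < b \<and> b \<le> n \<and> l \<in> {1..k} \<and>
     block (layer p 1) a \<noteq> block (layer p 1) b \<and>
     b = Min (block (layer p 1) b) \<and>
     a = Min (block (layer p l) a))"

definition label_less :: "label \<Rightarrow> label \<Rightarrow> bool" where
  "label_less = (\<lambda>(a1, b1, l1) (a2, b2, l2).
     l1 > l2 \<or> (l1 = l2 \<and> a1 < a2) \<or> (l1 = l2 \<and> a1 = a2 \<and> b1 < b2))"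


subsection \<open>The poset with adjoined top element\<close>

datatype wp_top = Wp wpartition | Top

definition L_carrier :: "nat \<Rightarrow> nat \<Rightarrow> wp_top set" where
  "L_carrier n k = insert Top (Wp ` weighted_partitions n k)"

inductive labeled_cover :: "nat \<Rightarrow> nat \<Rightarrow> wp_top \<Rightarrow> label \<Rightarrow> wp_top \<Rightarrow> bool"
  for n k :: nat where
  merge: "p \<in> weighted_partitions n k \<Longrightarrow> admissible n k p (a, b, l) \<Longrightarrow>
     labeled_cover n k (Wp p) (a, b, l) (Wp (merge_layers a b l p))"
| top: "p \<in> weighted_partitions n k \<Longrightarrow> wp_rank n p = n - 1 \<Longrightarrow>
     labeled_cover n k (Wp p) (1, n, k) Top"

definition L_order :: "nat \<Rightarrow> nat \<Rightarrow> wp_top rel" where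
  "L_order n k = {(x, y). x \<in> L_carrier n k \<and> y \<in> L_carrier n k \<and>
     (x, y) \<in> {(u, v). \<exists>t. labeled_cover n k u t v}\<^sup>*}"

definition L_rank :: "nat \<Rightarrow> wp_top \<Rightarrow> nat" where
  "L_rank n x = (case x of Wp p \<Rightarrow> wp_rank n p | Top \<Rightarrow> n)"

end

theory Submission
  imports Defs
begin

text \<open>
  A weighted partition is determined by the minima of its blocks: write \<open>p\<^sub>m(i)\<close> for the minimum of
  the block of \<open>i\<close> in layer \<open>m\<close>. A label \<open>(a, b, l)\<close> removes \<open>b\<close> from the block minima of the
  layers up to \<open>l\<close>. Hence in an interval \<open>[p, q]\<close> every maximal chain uses each layer-1 minimum \<open>b\<close> of
  \<open>p\<close> that is not one of \<open>q\<close> exactly once as second entry of a label, and the third entry of that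
  label is forced: it is the largest \<open>l\<close> with \<open>q\<^sub>l(b) \<noteq> b\<close>. Moreover the first entry \<open>a\<close> satisfies
  \<open>a \<ge> q\<^sub>l(b)\<close>. The least of the labels \<open>(q\<^sub>l(b), b, l)\<close> is admissible at \<open>p\<close>, bounds all labels
  of all chains from below, and occurs in every chain: if its \<open>b\<close> were attached to another \<open>a\<close>,
  then \<open>a\<close> itself would give rise to a smaller label. So a rising chain has to start with it, and
  induction applies. In an interval \<open>[p, Top]\<close> the last label \<open>(1, n, k)\<close> forces all labels of a
  rising chain to be of the form \<open>(1, b, k)\<close>.
\<close>

section \<open>Block minima of a partition\<close>

definition bmin :: "nat set set \<Rightarrow> nat \<Rightarrow> nat" where
  "bmin Q i = Min (block Q i)"

lemma block_eqI:
  assumes "partition_on A Q" "X \<in> Q" "i \<in> X"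
  shows "block Q i = X"
  unfolding block_def
proof (rule the_equality)
  fix Y assume "Y \<in> Q \<and> i \<in> Y"
  then show "Y = X"
    using assms by (auto simp: partition_on_def disjoint_def)
qed (use assms in auto)

lemma block_mem:
  assumes "partition_on A Q" "i \<in> A"
  shows "block Q i \<in> Q" "i \<in> block Q i"
proof -
  obtain X where "X \<in> Q" "i \<in> X"
    using assms by (auto simp: partition_on_def)
  then show "block Q i \<in> Q" "i \<in> block Q i"
    using block_eqI[OF assms(1)] by auto
qed

context
  fixes A :: "nat set" and Q :: "nat set set"
  assumes fin: "finite A" and part: "partition_on A Q"
begin

lemma part_finite: "X \<in> Q \<Longrightarrow> finite X"
  using fin part by (metis Sup_upper finite_subset partition_onD1)

lemma bmin_in_block: "i \<in> A \<Longrightarrow> bmin Q i \<in> block Q i"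
  unfolding bmin_def using block_mem[OF part] part_finite by (metis Min_in empty_iff)

lemma bmin_in: "i \<in> A \<Longrightarrow> bmin Q i \<in> A"
  using bmin_in_block block_mem(1)[OF part] part by (auto simp: partition_on_def)

lemma bmin_le: "i \<in> A \<Longrightarrow> bmin Q i \<le> i"
  unfolding bmin_def using block_mem[OF part] part_finite by simp

lemma block_bmin: "i \<in> A \<Longrightarrow> block Q (bmin Q i) = block Q i"
  using bmin_in_block block_mem(1)[OF part] block_eqI[OF part] by blast

lemma bmin_idem: "i \<in> A \<Longrightarrow> bmin Q (bmin Q i) = bmin Q i"
  using block_bmin by (simp add: bmin_def)

lemma bmin_eq_iff: "i \<in> A \<Longrightarrow> j \<in> A \<Longrightarrow> bmin Q i = bmin Q j \<longleftrightarrow> block Q i = block Q j"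
  using block_bmin by (metis bmin_def)

lemma mem_block_iff: "i \<in> A \<Longrightarrow> j \<in> block Q i \<longleftrightarrow> j \<in> A \<and> bmin Q j = bmin Q i"
proof
  assume i: "i \<in> A" and j: "j \<in> block Q i"
  then have "block Q j = block Q i"
    using block_eqI[OF part] block_mem[OF part] by blast
  then show "j \<in> A \<and> bmin Q j = bmin Q i"
    using i j block_mem(1)[OF part i] part by (auto simp: partition_on_def bmin_def)
next
  assume "i \<in> A" "j \<in> A \<and> bmin Q j = bmin Q i"
  then show "j \<in> block Q i"
    using bmin_eq_iff block_mem[OF part] by metis
qed

lemma partition_eq_blocks: "Q = block Q ` A"
proof
  show "Q \<subseteq> block Q ` A"
  proof
    fix X assume X: "X \<in> Q"
    then have "X \<noteq> {}" "X \<subseteq> A"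
      using part by (auto simp: partition_on_def)
    then obtain i where i: "i \<in> X" "i \<in> A"
      by blast
    show "X \<in> block Q ` A"
      using block_eqI[OF part X i(1)] i(2) by (intro image_eqI[where x = i]) simp_all
  qed
  show "block Q ` A \<subseteq> Q"
    using block_mem(1)[OF part] by blast
qed

text \<open>Each block contains exactly one fixed point of \<open>bmin Q\<close>, its minimum, so
  \<open>block Q\<close> maps the fixed points bijectively onto the blocks. Ranks can then be found
  by counting fixed points.\<close>

lemma card_partition_bmin: "card Q = card {i \<in> A. bmin Q i = i}"
proof -
  have "bij_betw (block Q) {i \<in> A. bmin Q i = i} Q"
  proof (rule bij_betw_imageI)
    show "inj_on (block Q) {i \<in> A. bmin Q i = i}"
      by (rule inj_onI) (metis (mono_tags, lifting) bmin_eq_iff mem_Collect_eq)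
    have "\<exists>j \<in> {i \<in> A. bmin Q i = i}. block Q j = block Q i" if "i \<in> A" for i
      using that bmin_in bmin_idem block_bmin by blast
    then have "block Q ` {i \<in> A. bmin Q i = i} = block Q ` A"
      by (force simp: image_iff)
    then show "block Q ` {i \<in> A. bmin Q i = i} = Q"
      by (subst (3) partition_eq_blocks)
  qed
  then show ?thesis
    by (metis bij_betw_same_card)
qed

end

lemma partition_eqI_bmin:
  assumes "finite A" "partition_on A P" "partition_on A Q"
    and "\<And>i. i \<in> A \<Longrightarrow> bmin P i = bmin Q i"
  shows "P = Q"
proof -
  have "block P i = block Q i" if "i \<in> A" for i
    using that assms(4) mem_block_iff[OF assms(1,2)] mem_block_iff[OF assms(1,3)] by auto
  then show ?thesis
    by (subst partition_eq_blocks[OF assms(1,2)], subst partition_eq_blocks[OF assms(1,3)])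
      (simp cong: image_cong)
qed

text \<open>Blocks are the fibres of \<open>bmin\<close>. Refinement puts an element and its
  \<open>P\<close>-minimum into one \<open>Q\<close>-block; conversely, the equation makes the
  \<open>Q\<close>-minimum depend only on the \<open>P\<close>-minimum.\<close>

lemma refines_iff_bmin:
  assumes fin: "finite A" and P: "partition_on A P" and Q: "partition_on A Q"
  shows "refines A P Q \<longleftrightarrow> (\<forall>i\<in>A. bmin Q (bmin P i) = bmin Q i)"
proof
  assume "refines A P Q"
  show "\<forall>i\<in>A. bmin Q (bmin P i) = bmin Q i"
  proof
    fix i assume i: "i \<in> A"
    then obtain Y where Y: "Y \<in> Q" "block P i \<subseteq> Y"
      using \<open>refines A P Q\<close> block_mem(1)[OF P i] by (auto simp: refines_def)
    then have "block Q (bmin P i) = Y" "block Q i = Y"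
      using bmin_in_block[OF fin P i] block_mem(2)[OF P i] block_eqI[OF Q] by auto
    then show "bmin Q (bmin P i) = bmin Q i"
      by (simp add: bmin_def)
  qed
next
  assume *: "\<forall>i\<in>A. bmin Q (bmin P i) = bmin Q i"
  have "\<exists>Y\<in>Q. block P i \<subseteq> Y" if i: "i \<in> A" for i
  proof
    show "block P i \<subseteq> block Q i"
      using mem_block_iff[OF fin P i] mem_block_iff[OF fin Q i] * i by (metis subsetI)
  qed (use block_mem[OF Q i] in auto)
  then have "\<forall>X\<in>P. \<exists>Y\<in>Q. X \<subseteq> Y"
    by (subst partition_eq_blocks[OF fin P]) blast
  then show "refines A P Q"
    unfolding refines_def using P Q by blast
qed

lemma
  assumes fin: "finite A" and Q: "partition_on A Q" and a: "a \<in> A" and b: "b \<in> A"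
  shows partition_on_merge_blocks: "partition_on A (merge_blocks a b Q)"
    and bmin_merge_blocks: "i \<in> A \<Longrightarrow> bmin (merge_blocks a b Q) i =
      (if bmin Q i \<in> {bmin Q a, bmin Q b} then min (bmin Q a) (bmin Q b) else bmin Q i)"
proof -
  note Qa = block_mem[OF Q a] and Qb = block_mem[OF Q b]
  show part: "partition_on A (merge_blocks a b Q)"
  proof (rule partition_onI)
    show "\<Union> (merge_blocks a b Q) = A"
      using Q Qa Qb unfolding merge_blocks_def partition_on_def by blast
    show "{} \<notin> merge_blocks a b Q"
      using Q Qa Qb unfolding merge_blocks_def partition_on_def by blast
    show "disjnt X Y" if "X \<in> merge_blocks a b Q" "Y \<in> merge_blocks a b Q" "X \<noteq> Y" for X Y
      using that Q Qa Qb unfolding merge_blocks_def partition_on_def disjoint_def disjnt_def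
      by auto
  qed
  have ab: "block Q a \<union> block Q b \<in> merge_blocks a b Q"
    by (simp add: merge_blocks_def)
  show "bmin (merge_blocks a b Q) i =
      (if bmin Q i \<in> {bmin Q a, bmin Q b} then min (bmin Q a) (bmin Q b) else bmin Q i)"
    if i: "i \<in> A"
  proof (cases "bmin Q i \<in> {bmin Q a, bmin Q b}")
    case True
    then have "i \<in> block Q a \<union> block Q b"
      using mem_block_iff[OF fin Q a] mem_block_iff[OF fin Q b] i by auto
    then have "block (merge_blocks a b Q) i = block Q a \<union> block Q b"
      by (rule block_eqI[OF part ab])
    moreover have "Min (block Q a \<union> block Q b) = min (bmin Q a) (bmin Q b)"
      unfolding bmin_def using Qa Qb part_finite[OF fin Q] by (intro Min_Un) auto
    ultimately show ?thesis
      using True by (simp add: bmin_def)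
  next
    case False
    then have "block Q i \<in> merge_blocks a b Q"
      using bmin_eq_iff[OF fin Q] i a b block_mem[OF Q i] by (auto simp: merge_blocks_def)
    then have "block (merge_blocks a b Q) i = block Q i"
      using block_eqI[OF part] block_mem[OF Q i] by blast
    then show ?thesis
      using False by (simp add: bmin_def)
  qed
qed

section \<open>A criterion for EL-labelings\<close>

text \<open>Paths keep the labels and forget the inner vertices, and no order enters. The same
  notion thus describes both the closure behind \<open>L_order\<close> and the label sequences of
  maximal chains.\<close>

fun labeled_path :: "('a \<Rightarrow> 'l \<Rightarrow> 'a \<Rightarrow> bool) \<Rightarrow> 'a \<Rightarrow> 'l list \<Rightarrow> 'a \<Rightarrow> bool" where
  "labeled_path E x [] y \<longleftrightarrow> x = y"
| "labeled_path E x (t # ts) y \<longleftrightarrow> (\<exists>z. E x t z \<and> labeled_path E z ts y)"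

lemma edge_label_eq:
  assumes "edge_labeling r E" "E x t y"
  shows "edge_label E x y = t"
proof -
  have "\<exists>!t. E x t y"
    using assms unfolding edge_labeling_def by blast
  then show ?thesis
    unfolding edge_label_def using assms(2) by blast
qed

lemma edge_label_edge:
  assumes "edge_labeling r E" "hasse_cover r x y"
  shows "E x (edge_label E x y) y"
proof -
  obtain t where "E x t y"
    using assms unfolding edge_labeling_def by blast
  then show ?thesis
    using edge_label_eq[OF assms(1)] by simp
qed

lemma maximal_chain_Cons:
  "maximal_chain r x y (w # c) \<longleftrightarrow>
     w = x \<and> (if c = [] then x = y else hasse_cover r x (hd c) \<and> maximal_chain r (hd c) y c)"
  by (auto simp: maximal_chain_def successively_Cons)

lemma chain_labels_Cons:
  "chain_labels lab (x # c) = (if c = [] then [] else lab x (hd c) # chain_labels lab c)"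
  by (cases c) (auto simp: chain_labels_def)

lemma labeled_path_chain_labels:
  assumes "edge_labeling r E" "maximal_chain r x y c"
  shows "labeled_path E x (chain_labels (edge_label E) c) y"
  using assms(2)
proof (induction c arbitrary: x)
  case Nil
  then show ?case
    by (simp add: maximal_chain_def)
next
  case (Cons w c)
  then show ?case
    using edge_label_edge[OF assms(1)]
    by (auto simp: maximal_chain_Cons chain_labels_Cons split: if_splits)
qed

lemma maximal_chain_le:
  assumes "partial_order_on P r" "maximal_chain r x y c" "y \<in> P"
  shows "(x, y) \<in> r"
  using assms(2)
proof (induction c arbitrary: x)
  case Nil
  then show ?case
    by (simp add: maximal_chain_def)
next
  case (Cons w c)
  have "refl_on P r" "trans r"
    using assms(1) by (auto simp: partial_order_on_def preorder_on_def)
  then show ?case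
    using Cons assms(3)
    by (auto simp: maximal_chain_Cons hasse_cover_def refl_on_def split: if_splits dest: transD)
qed

text \<open>The label \<open>t0\<close> in \<open>least\<close> bounds all labels on paths to
  \<open>y\<close> from below and occurs on every rising one. A rising path is sorted, so
  \<open>t0\<close> must come first, and \<open>det\<close> then fixes the second vertex; the rest
  is induction on the rank difference.\<close>

lemma EL_labelingI:
  fixes \<rho> :: "'a \<Rightarrow> nat" and lt :: "'l \<Rightarrow> 'l \<Rightarrow> bool"
  assumes graded: "graded_poset P r \<rho>"
    and lab: "edge_labeling r E"
    and det: "\<And>x t z z'. E x t z \<Longrightarrow> E x t z' \<Longrightarrow> z = z'"
    and irrefl: "\<And>t. \<not> lt t t"
    and trans: "\<And>s t u. lt s t \<Longrightarrow> lt t u \<Longrightarrow> lt s u"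
    and least: "\<And>x y. (x, y) \<in> r \<Longrightarrow> x \<noteq> y \<Longrightarrow>
      \<exists>t0 z. E x t0 z \<and> (z, y) \<in> r \<and> (\<forall>ts. labeled_path E x ts y \<longrightarrow>
        (\<forall>t\<in>set ts. t0 = t \<or> lt t0 t) \<and>
        (successively (\<lambda>s t. s = t \<or> lt s t) ts \<longrightarrow> t0 \<in> set ts))"
  shows "EL_labeling P r \<rho> lt E"
proof -
  let ?L = "edge_label E"
  let ?M = "\<lambda>x y c. maximal_chain r x y c \<and> rising lt ?L c"
  have po: "partial_order_on P r" and mono: "\<And>x y. (x, y) \<in> r \<Longrightarrow> x \<noteq> y \<Longrightarrow> \<rho> x < \<rho> y"
    using graded by (auto simp: graded_poset_def)
  have anti: "antisym r" and field: "r \<subseteq> P \<times> P"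
    using po by (auto simp: partial_order_on_def preorder_on_def)
  have cover: "hasse_cover r x z" if "E x t z" for x t z
    using lab that by (auto simp: edge_labeling_def)
  have sorted_hd: "s = t \<or> lt s t" if "successively (\<lambda>s t. s = t \<or> lt s t) (s # ts)" "t \<in> set ts"
    for s t ts
  proof -
    have "transp (\<lambda>s t. s = t \<or> lt s t)"
      using trans by (auto intro!: transpI)
    then show ?thesis
      using that by (simp add: successively_conv_sorted_wrt)
  qed
  have trivial: "c = [x]" if c: "maximal_chain r x x c" and "x \<in> P" for x c
  proof (cases c)
    case Nil
    then show ?thesis
      using c by (simp add: maximal_chain_def)
  next
    case (Cons w d)
    have False if "d \<noteq> []"
    proof -
      have "hasse_cover r x (hd d)" "maximal_chain r (hd d) x d"
        using c Cons that by (auto simp: maximal_chain_Cons)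
      then show False
        using maximal_chain_le[OF po _ \<open>x \<in> P\<close>] anti by (auto simp: hasse_cover_def antisym_def)
    qed
    then show ?thesis
      using c Cons by (auto simp: maximal_chain_Cons)
  qed
  have step: "\<exists>t0 z. E x t0 z \<and> (z, y) \<in> r \<and> \<rho> y - \<rho> z < \<rho> y - \<rho> x \<and>
      (\<forall>c. maximal_chain r x y c \<longrightarrow> (\<forall>t\<in>set (chain_labels ?L c). t0 = t \<or> lt t0 t)) \<and>
      (\<forall>c. ?M x y c \<longrightarrow> (\<exists>d. c = x # d \<and> d \<noteq> [] \<and> hd d = z \<and> ?M z y d))"
    if xy: "(x, y) \<in> r" "x \<noteq> y" for x y
  proof -
    obtain t0 z where z: "E x t0 z" "(z, y) \<in> r"
      and t0: "\<And>ts. labeled_path E x ts y \<Longrightarrow>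
        (\<forall>t\<in>set ts. t0 = t \<or> lt t0 t) \<and>
        (successively (\<lambda>s t. s = t \<or> lt s t) ts \<longrightarrow> t0 \<in> set ts)"
      using least[OF xy] by blast
    have "\<rho> x < \<rho> z" "\<rho> x < \<rho> y"
      using mono xy cover[OF z(1)] by (auto simp: hasse_cover_def)
    then have "\<rho> y - \<rho> z < \<rho> y - \<rho> x"
      by simp
    moreover have "\<exists>d. c = x # d \<and> d \<noteq> [] \<and> hd d = z \<and> ?M z y d" if c: "?M x y c" for c
    proof -
      obtain d where d: "c = x # d" "d \<noteq> []" "hasse_cover r x (hd d)" "maximal_chain r (hd d) y d"
        using c xy(2) by (cases c) (auto simp: maximal_chain_Cons maximal_chain_def[of _ _ _ "[]"] split: if_splits)
      have labels: "chain_labels ?L c = ?L x (hd d) # chain_labels ?L d"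
        using d by (simp add: chain_labels_Cons)
      have rise: "successively (\<lambda>s t. s = t \<or> lt s t) (?L x (hd d) # chain_labels ?L d)"
        using c labels by (simp add: rising_def)
      \<comment> \<open>The first label is at least \<open>t0\<close>, a lower bound, and at most
        \<open>t0\<close>, which occurs in the sorted list; so the two agree.\<close>
      have "t0 = ?L x (hd d) \<or> lt t0 (?L x (hd d))" "t0 \<in> set (?L x (hd d) # chain_labels ?L d)"
        using t0[OF labeled_path_chain_labels[OF lab conjunct1[OF c]]] rise unfolding labels
        by (simp, blast)
      then have "?L x (hd d) = t0"
        using sorted_hd[OF rise] irrefl trans by (metis set_ConsD)
      then have "hd d = z"
        using det edge_label_edge[OF lab d(3)] z(1) by metis
      moreover have "rising lt ?L d"
        using rise by (auto simp: rising_def successively_Cons)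
      ultimately show ?thesis
        using d by blast
    qed
    moreover have "\<forall>t\<in>set (chain_labels ?L c). t0 = t \<or> lt t0 t" if "maximal_chain r x y c" for c
      using t0[OF labeled_path_chain_labels[OF lab that]] by blast
    ultimately show ?thesis
      using z by blast
  qed
  \<comment> \<open>Prefixing \<open>x\<close> to a rising chain from \<open>z\<close> keeps it
    rising, since \<open>t0\<close> bounds every label of the new chain from below.\<close>
  have exists: "\<exists>c. ?M x y c" if "(x, y) \<in> r" for x y
    using that
  proof (induction "\<rho> y - \<rho> x" arbitrary: x rule: less_induct)
    case less
    show ?case
    proof (cases "x = y")
      case True
      then have "?M x y [x]"
        by (simp add: maximal_chain_def rising_def chain_labels_def)
      then show ?thesis
        by blast
    next
      case False
      then obtain t0 z where z: "E x t0 z" "(z, y) \<in> r" "\<rho> y - \<rho> z < \<rho> y - \<rho> x"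
        and t0: "\<And>c. maximal_chain r x y c \<Longrightarrow> \<forall>t\<in>set (chain_labels ?L c). t0 = t \<or> lt t0 t"
        using step[OF less.prems] by blast
      obtain d where d: "?M z y d"
        using less.hyps[OF z(3,2)] by blast
      then have "d \<noteq> []" "hd d = z"
        by (auto simp: maximal_chain_def)
      then have c: "maximal_chain r x y (x # d)"
        using d cover[OF z(1)] by (auto simp: maximal_chain_Cons)
      have "chain_labels ?L (x # d) = t0 # chain_labels ?L d"
        using \<open>d \<noteq> []\<close> \<open>hd d = z\<close> edge_label_eq[OF lab z(1)] by (simp add: chain_labels_Cons)
      then have "rising lt ?L (x # d)"
        using d t0[OF c] by (auto simp: rising_def successively_Cons)
      then show ?thesis
        using c by blast
    qed
  qed
  have unique: "c = c'" if "(x, y) \<in> r" "?M x y c" "?M x y c'" for x y c c'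
    using that
  proof (induction "\<rho> y - \<rho> x" arbitrary: x c c' rule: less_induct)
    case less
    show ?case
    proof (cases "x = y")
      case True
      then show ?thesis
        using trivial less.prems field by blast
    next
      case False
      then obtain z where z: "(z, y) \<in> r" "\<rho> y - \<rho> z < \<rho> y - \<rho> x"
        and M: "\<And>c. ?M x y c \<Longrightarrow> \<exists>d. c = x # d \<and> d \<noteq> [] \<and> hd d = z \<and> ?M z y d"
        using step[OF less.prems(1)] by blast
      obtain d d' where "c = x # d" "?M z y d" "c' = x # d'" "?M z y d'"
        using M[OF less.prems(2)] M[OF less.prems(3)] by blast
      then show ?thesis
        using less.hyps[OF z(2,1)] by blast
    qed
  qed
  \<comment> \<open>By \<open>exists\<close>, some maximal chain of the interval starts with
    \<open>x\<close> and \<open>w\<close>, so its first label is bounded below by \<open>t0\<close>;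
    \<open>det\<close> excludes equality because \<open>w\<close> is not \<open>z\<close>.\<close>
  have first: "lt (?L x (c ! 1)) (?L x w)"
    if xy: "(x, y) \<in> r" and c: "?M x y c" and w: "hasse_cover r x w" "(w, y) \<in> r" "w \<noteq> c ! 1"
    for x y c w
  proof -
    have "x \<noteq> y"
      using w anti by (auto simp: hasse_cover_def antisym_def)
    then obtain t0 z where z: "E x t0 z"
      and t0: "\<And>c. maximal_chain r x y c \<Longrightarrow> \<forall>t\<in>set (chain_labels ?L c). t0 = t \<or> lt t0 t"
      and M: "\<And>c. ?M x y c \<Longrightarrow> \<exists>d. c = x # d \<and> d \<noteq> [] \<and> hd d = z \<and> ?M z y d"
      using step[OF xy] by blast
    have c1: "c ! 1 = z"
      using M[OF c] by (auto simp: hd_conv_nth)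
    obtain d where d: "?M w y d"
      using exists[OF w(2)] by blast
    then have "d \<noteq> []" "hd d = w"
      by (auto simp: maximal_chain_def)
    then have "maximal_chain r x y (x # d)" "?L x w \<in> set (chain_labels ?L (x # d))"
      using d w by (auto simp: maximal_chain_Cons chain_labels_Cons)
    then have "t0 = ?L x w \<or> lt t0 (?L x w)"
      using t0 by blast
    moreover have "t0 \<noteq> ?L x w"
      using det z edge_label_edge[OF lab w(1)] w(3) c1 by metis
    ultimately show ?thesis
      using edge_label_eq[OF lab z] c1 by simp
  qed
  show ?thesis
    unfolding EL_labeling_def
  proof (intro conjI allI impI)
    show "\<exists>!c. ?M x y c" if "(x, y) \<in> r" for x y
      using exists[OF that] unique[OF that] by blast
  qed (use graded lab first in auto)
qed

section \<open>Weighted partitions through the minima of their blocks\<close>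

definition wmin :: "wpartition \<Rightarrow> nat \<Rightarrow> nat \<Rightarrow> nat" where
  "wmin p m i = bmin (layer p m) i"

definition mins :: "nat \<Rightarrow> wpartition \<Rightarrow> nat \<Rightarrow> nat set" where
  "mins n p m = {i \<in> {1..n}. wmin p m i = i}"

lemma wp_partition_on:
  "p \<in> weighted_partitions n k \<Longrightarrow> m \<in> {1..k} \<Longrightarrow> partition_on {1..n} (layer p m)"
  by (simp add: weighted_partitions_def)

lemma weighted_partitions_iff:
  "p \<in> weighted_partitions n k \<longleftrightarrow> length p = k \<and>
     (\<forall>m\<in>{1..k}. partition_on {1..n} (layer p m)) \<and>
     (\<forall>m i. 1 \<le> m \<and> m < k \<and> i \<in> {1..n} \<longrightarrow> wmin p m (wmin p (m + 1) i) = wmin p m i)"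
proof -
  have "refines {1..n} (layer p (m + 1)) (layer p m) \<longleftrightarrow>
      (\<forall>i\<in>{1..n}. wmin p m (wmin p (m + 1) i) = wmin p m i)"
    if "\<forall>m\<in>{1..k}. partition_on {1..n} (layer p m)" "1 \<le> m" "m < k" for m
    unfolding wmin_def using that by (intro refines_iff_bmin) auto
  then show ?thesis
    unfolding weighted_partitions_def by blast
qed

section \<open>Comparison of block minima across layers\<close>

context
  fixes n k :: nat and p :: wpartition
  assumes p: "p \<in> weighted_partitions n k"
begin

lemma wmin_in: "m \<in> {1..k} \<Longrightarrow> i \<in> {1..n} \<Longrightarrow> wmin p m i \<in> {1..n}"
  unfolding wmin_def using bmin_in[OF _ wp_partition_on[OF p]] by blast

lemma wmin_le: "m \<in> {1..k} \<Longrightarrow> i \<in> {1..n} \<Longrightarrow> wmin p m i \<le> i"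
  unfolding wmin_def using bmin_le[OF _ wp_partition_on[OF p]] by blast

lemma wmin_idem: "m \<in> {1..k} \<Longrightarrow> i \<in> {1..n} \<Longrightarrow> wmin p m (wmin p m i) = wmin p m i"
  unfolding wmin_def using bmin_idem[OF _ wp_partition_on[OF p]] by blast

lemma refines_layer:
  assumes "m \<le> m'" "1 \<le> m" "m' \<le> k"
  shows "refines {1..n} (layer p m') (layer p m)"
  using assms
proof (induction m' rule: dec_induct)
  case base
  then show ?case
    using refines_refl[OF wp_partition_on[OF p]] by simp
next
  case (step j)
  then have "refines {1..n} (layer p (Suc j)) (layer p j)"
    using p unfolding weighted_partitions_def by auto
  then show ?case
    using step by (auto intro: refines_trans)
qed

lemma wmin_refine:
  assumes "m \<le> m'" "1 \<le> m" "m' \<le> k" "i \<in> {1..n}"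
  shows "wmin p m (wmin p m' i) = wmin p m i"
  using refines_layer[OF assms(1-3)] refines_iff_bmin[of "{1..n}" "layer p m'" "layer p m"]
    wp_partition_on[OF p] assms by (simp add: wmin_def)

text \<open>Because layer \<open>m'\<close> is finer, \<open>wmin p m i\<close> is also the
  layer-\<open>m\<close> minimum of \<open>wmin p m' i\<close>, hence at most that element.\<close>

lemma wmin_mono:
  assumes "m \<le> m'" "1 \<le> m" "m' \<le> k" "i \<in> {1..n}"
  shows "wmin p m i \<le> wmin p m' i"
  using wmin_refine[OF assms] wmin_le[of m "wmin p m' i"] wmin_in[of m' i] assms by auto

lemma wmin_fixed_mono:
  assumes "wmin p m i = i" "m \<le> m'" "1 \<le> m" "m' \<le> k" "i \<in> {1..n}"
  shows "wmin p m' i = i"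
  using wmin_mono[OF assms(2-)] wmin_le[of m' i] assms by auto

lemma admissible_iff:
  "admissible n k p (a, b, l) \<longleftrightarrow>
     1 \<le> a \<and> a < b \<and> b \<le> n \<and> l \<in> {1..k} \<and> wmin p 1 b = b \<and> wmin p l a = a"
proof
  assume R: "1 \<le> a \<and> a < b \<and> b \<le> n \<and> l \<in> {1..k} \<and> wmin p 1 b = b \<and> wmin p l a = a"
  \<comment> \<open>The layer-1 blocks of \<open>a\<close> and \<open>b\<close> differ because their
    minima do: \<open>wmin p 1 a <= a < b = wmin p 1 b\<close>.\<close>
  then have "wmin p 1 a \<noteq> wmin p 1 b"
    using wmin_le[of 1 a] by auto
  then show "admissible n k p (a, b, l)"
    using R by (auto simp: admissible_def wmin_def bmin_def)
qed (auto simp: admissible_def wmin_def bmin_def)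

lemma wp_card_layer: "k \<ge> 1 \<Longrightarrow> card (layer p 1) = card (mins n p 1)"
  unfolding mins_def wmin_def using card_partition_bmin[OF _ wp_partition_on[OF p]] by simp

lemma one_in_mins: "n \<ge> 1 \<Longrightarrow> m \<in> {1..k} \<Longrightarrow> 1 \<in> mins n p m"
  unfolding mins_def using wmin_le[of m 1] wmin_in[of m 1] by auto

end

lemma wp_eqI:
  assumes p: "p \<in> weighted_partitions n k" and q: "q \<in> weighted_partitions n k"
    and eq: "\<And>m i. m \<in> {1..k} \<Longrightarrow> i \<in> {1..n} \<Longrightarrow> wmin p m i = wmin q m i"
  shows "p = q"
proof (rule nth_equalityI)
  show "length p = length q"
    using p q by (simp add: weighted_partitions_def)
  fix j assume "j < length p"
  then have j: "Suc j \<in> {1..k}"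
    using p by (simp add: weighted_partitions_def)
  have "layer p (Suc j) = layer q (Suc j)"
    using eq[OF j] wp_partition_on[OF p j] wp_partition_on[OF q j]
    by (intro partition_eqI_bmin[of "{1..n}"]) (auto simp: wmin_def)
  then show "p ! j = q ! j"
    by (simp add: layer_def)
qed

lemma layer_merge_layers:
  "m \<in> {1..length p} \<Longrightarrow>
   layer (merge_layers a b l p) m = (if m \<le> l then merge_blocks a b (layer p m) else layer p m)"
  unfolding merge_layers_def layer_def[of "map _ _"] by (subst nth_map) (auto simp del: upt_Suc)

section \<open>The effect of a single merge on block minima\<close>

context
  fixes n k :: nat and p :: wpartition and a b l :: nat
  assumes p: "p \<in> weighted_partitions n k" and adm: "admissible n k p (a, b, l)"
begin

lemma admissibleD: "1 \<le> a" "a < b" "b \<le> n" "l \<in> {1..k}" "wmin p 1 b = b" "wmin p l a = a"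
  using adm by (simp_all add: admissible_iff[OF p])

lemma adm_in: "a \<in> {1..n}" "b \<in> {1..n}"
  using admissibleD by auto

lemma adm_fixed: "m \<in> {1..k} \<Longrightarrow> wmin p m b = b"
  using wmin_fixed_mono[OF p admissibleD(5)] adm_in by simp

lemma adm_less: "m \<in> {1..k} \<Longrightarrow> wmin p m a < b"
  using wmin_le[OF p, of m a] adm_in admissibleD(2) by simp

text \<open>In every layer \<open>b\<close> is the minimum of its own block, while the block of
  \<open>a\<close> has a smaller minimum. The union therefore inherits \<open>wmin p m a\<close>,
  and only the old block of \<open>b\<close> changes its minimum.\<close>

lemma wmin_merge:
  assumes "m \<in> {1..k}" "i \<in> {1..n}"
  shows "wmin (merge_layers a b l p) m i =
    (if m \<le> l \<and> wmin p m i = b then wmin p m a else wmin p m i)"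
proof -
  have "m \<in> {1..length p}"
    using assms(1) p by (simp add: weighted_partitions_def)
  then show ?thesis
    using bmin_merge_blocks[OF _ wp_partition_on[OF p assms(1)] adm_in assms(2)]
      adm_fixed[OF assms(1)] adm_less[OF assms(1)]
    by (auto simp: wmin_def layer_merge_layers)
qed

lemma merge_in_weighted_partitions: "merge_layers a b l p \<in> weighted_partitions n k"
  unfolding weighted_partitions_iff
proof (intro conjI ballI allI impI)
  show len: "length (merge_layers a b l p) = k"
    using p by (simp add: merge_layers_def weighted_partitions_def)
  show "partition_on {1..n} (layer (merge_layers a b l p) m)" if "m \<in> {1..k}" for m
  proof -
    have "m \<in> {1..length p}"
      using that p by (simp add: weighted_partitions_def)
    then show ?thesis
      using partition_on_merge_blocks[OF _ wp_partition_on[OF p that] adm_in] wp_partition_on[OF p that]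
      by (simp add: layer_merge_layers)
  qed
  fix m i assume *: "1 \<le> m \<and> m < k \<and> i \<in> {1..n}"
  then have m: "m \<in> {1..k}" "m + 1 \<in> {1..k}" "i \<in> {1..n}"
    by auto
  have refine: "wmin p m (wmin p (m + 1) j) = wmin p m j" if "j \<in> {1..n}" for j
    using wmin_refine[OF p, of m "m + 1" j] m that by simp
  show "wmin (merge_layers a b l p) m (wmin (merge_layers a b l p) (m + 1) i) =
      wmin (merge_layers a b l p) m i"
  \<comment> \<open>If layer \<open>m + 1\<close> moves \<open>i\<close> away from \<open>b\<close>,
    layer \<open>m\<close> is merged as well and both sides become \<open>wmin p m a\<close>.
    Otherwise \<open>i\<close> keeps its layer \<open>m + 1\<close> minimum and the old refinement
    equation applies.\<close>
  proof (cases "m + 1 \<le> l \<and> wmin p (m + 1) i = b")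
    case True
    then have "wmin p m i = b"
      using refine[OF m(3)] adm_fixed[OF m(1)] by simp
    then show ?thesis
      using True refine[OF adm_in(1)] wmin_in[OF p m(2) adm_in(1)] adm_less[OF m(1)] m
      by (simp add: wmin_merge)
  next
    case False
    then have "wmin (merge_layers a b l p) (m + 1) i = wmin p (m + 1) i"
      unfolding wmin_merge[OF m(2,3)] by argo
    then show ?thesis
      using refine[OF m(3)] by (simp only: wmin_merge[OF m(1,3)] wmin_merge[OF m(1) wmin_in[OF p m(2,3)]])
  qed
qed

lemma mins_merge:
  assumes "m \<in> {1..k}"
  shows "mins n (merge_layers a b l p) m = (if m \<le> l then mins n p m - {b} else mins n p m)"
proof -
  \<comment> \<open>No element of the old block of \<open>b\<close> turns into a new minimum:
    \<open>wmin p m a\<close> is itself an old minimum and is smaller than \<open>b\<close>.\<close>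
  have "wmin p m a \<noteq> i" if "i \<in> {1..n}" "wmin p m i = b" for i
    using wmin_idem[OF p assms adm_in(1)] adm_less[OF assms] that by auto
  then show ?thesis
    using adm_fixed[OF assms] wmin_idem[OF p assms adm_in(1)] assms unfolding mins_def
    by (auto simp: wmin_merge split: if_splits)
qed

lemma wmin_merge_refine:
  assumes "m \<in> {1..k}" "i \<in> {1..n}"
  shows "wmin (merge_layers a b l p) m (wmin p m i) = wmin (merge_layers a b l p) m i"
  using wmin_in[OF p assms] wmin_idem[OF p assms] assms by (simp add: wmin_merge)

lemma adm_mem_mins: "b \<in> mins n p 1"
  using adm_in admissibleD(5) by (simp add: mins_def)

text \<open>This yields the rank increase along covers and the decreasing measure for the inductions
  that build paths.\<close>

lemma card_mins_merge:
  "card (mins n p 1) = Suc (card (mins n (merge_layers a b l p) 1))"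
proof -
  have "mins n (merge_layers a b l p) 1 = mins n p 1 - {b}"
    using mins_merge[of 1] admissibleD(4) by simp
  moreover have "finite (mins n p 1)"
    by (simp add: mins_def)
  ultimately show ?thesis
    using adm_mem_mins by (metis card_Suc_Diff1)
qed

end

section \<open>The order on weighted partitions\<close>

text \<open>
  An intrinsic description of the order. The second condition reflects that blocks are only ever
  attached through the minimum of a block of layer 1.
\<close>

definition wp_le :: "nat \<Rightarrow> nat \<Rightarrow> wpartition \<Rightarrow> wpartition \<Rightarrow> bool" where
  "wp_le n k p q \<longleftrightarrow> (\<forall>m\<in>{1..k}. \<forall>i\<in>{1..n}.
     wmin q m (wmin p m i) = wmin q m i \<and>
     (wmin p m i = i \<and> wmin q m i \<noteq> i \<longrightarrow> wmin p 1 i = i))"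

text \<open>
  In every chain from \<open>p\<close> to \<open>q\<close>, the block with minimum \<open>b\<close> is attached by a label \<open>(_, b, l)\<close>.
\<close>

definition level :: "nat \<Rightarrow> nat \<Rightarrow> wpartition \<Rightarrow> wpartition \<Rightarrow> nat \<Rightarrow> nat \<Rightarrow> bool" where
  "level n k p q b l \<longleftrightarrow> b \<in> mins n p 1 \<and> l \<in> {1..k} \<and> wmin q l b \<noteq> b \<and>
     (\<forall>m\<in>{l<..k}. wmin q m b = b)"

lemma level_unique: "level n k p q b l \<Longrightarrow> level n k p q b l' \<Longrightarrow> l = l'"
  by (cases l l' rule: linorder_cases) (auto simp: level_def)

text \<open>The level is the last layer in which \<open>q\<close> moves \<open>b\<close>. The bound
  by \<open>m\<close> is kept for the minimality argument, which compares it with another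
  level.\<close>

lemma ex_level:
  assumes "b \<in> mins n p 1" "m \<in> {1..k}" "wmin q m b \<noteq> b"
  shows "\<exists>l\<ge>m. level n k p q b l"
proof -
  define S where "S = {l \<in> {1..k}. wmin q l b \<noteq> b}"
  define L where "L = Max S"
  have S: "finite S" "m \<in> S"
    using assms by (auto simp: S_def)
  then have L: "L \<in> S" "m \<le> L" and max: "\<And>j. j \<in> S \<Longrightarrow> j \<le> L"
    unfolding L_def by (auto intro!: Max_in)
  have "wmin q j b = b" if "j \<in> {L<..k}" for j
    using max[of j] that by (auto simp: S_def)
  then have "level n k p q b L"
    using assms(1) L(1) by (simp add: level_def S_def)
  then show ?thesis
    using L(2) by blast
qed

lemma wp_le_refine:
  "wp_le n k p q \<Longrightarrow> m \<in> {1..k} \<Longrightarrow> i \<in> {1..n} \<Longrightarrow> wmin q m (wmin p m i) = wmin q m i"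
  unfolding wp_le_def by blast

lemma wp_le_fixed:
  "wp_le n k p q \<Longrightarrow> m \<in> {1..k} \<Longrightarrow> i \<in> {1..n} \<Longrightarrow> wmin p m i = i \<Longrightarrow> wmin q m i \<noteq> i \<Longrightarrow>
   wmin p 1 i = i"
  unfolding wp_le_def by blast

lemma wp_le_refl: "p \<in> weighted_partitions n k \<Longrightarrow> wp_le n k p p"
  unfolding wp_le_def using wmin_idem by blast

text \<open>This is the step of the induction along paths. The only minimum lost by merging is
  \<open>b\<close>, and \<open>b\<close> is a layer-1 minimum of \<open>p\<close>; every other
  minimum is handled by the hypothesis on the merged partition.\<close>

lemma wp_le_merge:
  assumes p: "p \<in> weighted_partitions n k" and adm: "admissible n k p (a, b, l)"
    and le: "wp_le n k (merge_layers a b l p) q"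
  shows "wp_le n k p q"
  unfolding wp_le_def
proof (intro ballI conjI impI)
  let ?p' = "merge_layers a b l p"
  fix m i assume mi: "m \<in> {1..k}" "i \<in> {1..n}"
  have "wmin q m (wmin ?p' m (wmin p m i)) = wmin q m (wmin p m i)"
    using wp_le_refine[OF le mi(1) wmin_in[OF p mi]] .
  then show "wmin q m (wmin p m i) = wmin q m i"
    using wp_le_refine[OF le mi] wmin_merge_refine[OF p adm mi] by simp
  assume i: "wmin p m i = i \<and> wmin q m i \<noteq> i"
  show "wmin p 1 i = i"
  proof (cases "i = b")
    case False
    then have "i \<in> mins n ?p' m"
      using i mi mins_merge[OF p adm mi(1)] by (simp add: mins_def)
    then have "i \<in> mins n ?p' 1"
      using wp_le_fixed[OF le mi] i mi by (simp add: mins_def)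
    then show ?thesis
      using mins_merge[OF p adm, of 1] mi by (auto simp: mins_def split: if_splits)
  qed (use adm_mem_mins[OF p adm] in \<open>auto simp: mins_def\<close>)
qed

text \<open>A cover that stays below \<open>q\<close> has no choice of level. Merging makes
  \<open>a\<close> the layer-\<open>l\<close> minimum of \<open>b\<close>, and \<open>q\<close> must
  respect this, so \<open>wmin q l b = wmin q l a <= a < b\<close>.\<close>

lemma wp_le_merge_label:
  assumes p: "p \<in> weighted_partitions n k" and q: "q \<in> weighted_partitions n k"
    and adm: "admissible n k p (a, b, l)"
    and le: "wp_le n k (merge_layers a b l p) q"
  shows "level n k p q b l" "wmin q l a = wmin q l b"
proof -
  let ?p' = "merge_layers a b l p"
  note ad = admissibleD[OF p adm] adm_in[OF p adm] adm_fixed[OF p adm]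
  have "wmin ?p' l b = a"
    using ad wmin_merge[OF p adm, of l b] by simp
  then show eq: "wmin q l a = wmin q l b"
    using wp_le_refine[OF le ad(4) ad(8)] by simp
  \<comment> \<open>Above layer \<open>l\<close>, \<open>b\<close> is still a minimum of the merged
    partition but no longer one in layer 1; the second clause of \<open>wp_le\<close> then forbids
    \<open>q\<close> to move it there.\<close>
  have "wmin q m b = b" if "m \<in> {l<..k}" for m
  proof (rule ccontr)
    assume "wmin q m b \<noteq> b"
    moreover have "wmin ?p' m b = b"
      using that ad wmin_merge[OF p adm, of m b] by auto
    ultimately have "wmin ?p' 1 b = b"
      using wp_le_fixed[OF le _ ad(8), of m] that by simp
    then show False
      using ad wmin_merge[OF p adm, of 1 b] adm_less[OF p adm, of 1] by auto
  qed
  moreover have "wmin q l b < b"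
    using eq wmin_le[OF q, of l a] ad by simp
  ultimately show "level n k p q b l"
    using ad by (auto simp: level_def mins_def)
qed

text \<open>Counterpart of the previous lemma: each level is realised by a cover that stays below
  \<open>q\<close>. The first entry is the minimum that \<open>b\<close> finally receives in layer
  \<open>l\<close> of \<open>q\<close>.\<close>

lemma level_merge_admissible:
  assumes p: "p \<in> weighted_partitions n k" and q: "q \<in> weighted_partitions n k"
    and le: "wp_le n k p q" and lev: "level n k p q b l"
  shows "admissible n k p (wmin q l b, b, l)" "wp_le n k (merge_layers (wmin q l b) b l p) q"
proof -
  let ?z = "wmin q l b"
  let ?p' = "merge_layers ?z b l p"
  have b: "b \<in> {1..n}" "wmin p 1 b = b" and l: "l \<in> {1..k}"
    and "?z \<noteq> b" and above: "\<And>m. m \<in> {l<..k} \<Longrightarrow> wmin q m b = b"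
    using lev by (auto simp: level_def mins_def)
  then have z: "?z \<in> {1..n}" "?z < b"
    using wmin_in[OF q l b(1)] wmin_le[OF q l b(1)] by auto
  \<comment> \<open>\<open>?z\<close> is a layer-\<open>l\<close> minimum of \<open>p\<close>: its
    \<open>p\<close>-minimum is at most \<open>?z\<close>, but has \<open>q\<close>-minimum
    \<open>?z\<close> and so cannot be smaller.\<close>
  have "wmin q l (wmin p l ?z) = ?z"
    using wp_le_refine[OF le l z(1)] wmin_idem[OF q l b(1)] by simp
  then have "?z \<le> wmin p l ?z"
    using wmin_le[OF q l wmin_in[OF p l z(1)]] by simp
  then have "wmin p l ?z = ?z"
    using wmin_le[OF p l z(1)] by simp
  then show adm: "admissible n k p (?z, b, l)"
    using z b l by (auto simp: admissible_iff[OF p])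
  show "wp_le n k ?p' q"
    unfolding wp_le_def
  proof (intro ballI conjI impI)
    fix m i assume mi: "m \<in> {1..k}" "i \<in> {1..n}"
    have refine: "wmin q m (wmin p m j) = wmin q m j" if "j \<in> {1..n}" for j
      using wp_le_refine[OF le mi(1) that] .
    show "wmin q m (wmin ?p' m i) = wmin q m i"
    \<comment> \<open>For \<open>m <= l\<close>, layer \<open>l\<close> of \<open>q\<close> refines
      layer \<open>m\<close>, so \<open>?z\<close> and \<open>b\<close> share a block of
      \<open>q\<close> in layer \<open>m\<close> too.\<close>
    proof (cases "m \<le> l \<and> wmin p m i = b")
      case True
      then have "wmin q m (wmin p m ?z) = wmin q m b"
        using refine[OF z(1)] wmin_refine[OF q, of m l b] mi l b by auto
      moreover have "wmin q m b = wmin q m i"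
        using refine[OF mi(2)] True by simp
      ultimately show ?thesis
        using True mi by (simp add: wmin_merge[OF p adm])
    qed (use mi refine wmin_merge[OF p adm] in auto)
    assume i: "wmin ?p' m i = i \<and> wmin q m i \<noteq> i"
    then have "i \<in> mins n ?p' m"
      using mi by (simp add: mins_def)
    then have mins: "i \<in> mins n p m" "m \<le> l \<longrightarrow> i \<noteq> b"
      using mins_merge[OF p adm mi(1)] by (auto split: if_splits)
    \<comment> \<open>For \<open>m <= l\<close> the merge has removed \<open>b\<close> from the
      minima; for \<open>m > l\<close> the level says that \<open>q\<close> fixes
      \<open>b\<close>.\<close>
    then have "i \<noteq> b"
      using above[of m] i mi by auto
    moreover have "i \<in> mins n p 1"
      using wp_le_fixed[OF le mi] mins i by (simp add: mins_def)
    ultimately show "wmin ?p' 1 i = i"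
      using mins_merge[OF p adm, of 1] l by (auto simp: mins_def)
  qed
qed

text \<open>Without any level, every block minimum of \<open>p\<close> stays a block minimum of
  \<open>q\<close>, and the refinement equation makes all minima agree.\<close>

lemma wp_le_ex_level:
  assumes p: "p \<in> weighted_partitions n k" and q: "q \<in> weighted_partitions n k"
    and le: "wp_le n k p q" and "p \<noteq> q"
  shows "\<exists>b l. level n k p q b l"
proof (rule ccontr)
  assume none: "\<nexists>b l. level n k p q b l"
  have "wmin p m i = wmin q m i" if mi: "m \<in> {1..k}" "i \<in> {1..n}" for m i
  proof -
    let ?z = "wmin p m i"
    have z: "?z \<in> {1..n}" "wmin p m ?z = ?z"
      using wmin_in[OF p mi] wmin_idem[OF p mi] by auto
    have "wmin q m ?z = ?z"
    proof (rule ccontr)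
      assume "wmin q m ?z \<noteq> ?z"
      moreover from this have "?z \<in> mins n p 1"
        using wp_le_fixed[OF le mi(1) z(1,2)] z by (simp add: mins_def)
      ultimately show False
        using ex_level mi(1) none by blast
    qed
    then show ?thesis
      using wp_le_refine[OF le mi] by simp
  qed
  then show False
    using wp_eqI[OF p q] \<open>p \<noteq> q\<close> by blast
qed

section \<open>Chains of labeled covers\<close>

lemma labeled_cover_Wp_Wp:
  "labeled_cover n k (Wp p) t (Wp q) \<longleftrightarrow> (\<exists>a b l. t = (a, b, l) \<and> p \<in> weighted_partitions n k \<and>
     admissible n k p (a, b, l) \<and> q = merge_layers a b l p)"
  by (auto elim: labeled_cover.cases intro: labeled_cover.intros)

lemma labeled_cover_Wp_Top:
  "labeled_cover n k (Wp p) t Top \<longleftrightarrow>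
     p \<in> weighted_partitions n k \<and> wp_rank n p = n - 1 \<and> t = (1, n, k)"
  using labeled_cover.top[of p n k] by (auto elim: labeled_cover.cases)

lemma not_labeled_cover_Top: "\<not> labeled_cover n k Top t y"
  by (auto elim: labeled_cover.cases)

lemma labeled_path_Top: "labeled_path (labeled_cover n k) Top ts y \<longleftrightarrow> ts = [] \<and> y = Top"
  by (cases ts) (auto simp: not_labeled_cover_Top)

lemma rtrancl_iff_labeled_path:
  "(x, y) \<in> {(u, v). \<exists>t. E u t v}\<^sup>* \<longleftrightarrow> (\<exists>ts. labeled_path E x ts y)"
proof
  assume "(x, y) \<in> {(u, v). \<exists>t. E u t v}\<^sup>*"
  then show "\<exists>ts. labeled_path E x ts y"
  proof (induction rule: converse_rtrancl_induct)
    case base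
    have "labeled_path E y [] y"
      by simp
    then show ?case ..
  next
    case (step x z)
    then obtain t ts where "E x t z" "labeled_path E z ts y"
      by blast
    then have "labeled_path E x (t # ts) y"
      by auto
    then show ?case ..
  qed
next
  assume "\<exists>ts. labeled_path E x ts y"
  then obtain ts where "labeled_path E x ts y" ..
  then show "(x, y) \<in> {(u, v). \<exists>t. E u t v}\<^sup>*"
    by (induction ts arbitrary: x) (auto intro: converse_rtrancl_into_rtrancl)
qed

lemma L_order_iff:
  "(x, y) \<in> L_order n k \<longleftrightarrow> x \<in> L_carrier n k \<and> y \<in> L_carrier n k \<and>
     (\<exists>ts. labeled_path (labeled_cover n k) x ts y)"
  unfolding L_order_def mem_Collect_eq split_conv rtrancl_iff_labeled_path ..

lemma Wp_in_L_carrier: "Wp p \<in> L_carrier n k \<longleftrightarrow> p \<in> weighted_partitions n k"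
  by (auto simp: L_carrier_def)

lemma labeled_cover_carrier:
  "labeled_cover n k x t y \<Longrightarrow> x \<in> L_carrier n k \<and> y \<in> L_carrier n k"
  by (induction rule: labeled_cover.induct)
    (auto simp: L_carrier_def intro: merge_in_weighted_partitions)

lemma labeled_path_wp_le:
  assumes "labeled_path (labeled_cover n k) (Wp p) ts (Wp q)" "p \<in> weighted_partitions n k"
  shows "wp_le n k p q"
  using assms
proof (induction ts arbitrary: p)
  case Nil
  then show ?case
    by (simp add: wp_le_refl)
next
  case (Cons t ts)
  then obtain z where z: "labeled_cover n k (Wp p) t z" "labeled_path (labeled_cover n k) z ts (Wp q)"
    by auto
  \<comment> \<open>\<open>Top\<close> has no outgoing edge, so a path ending in \<open>Wp q\<close>
    never visits it.\<close>
  then obtain p' where "z = Wp p'"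
    by (cases z) (auto simp: labeled_path_Top)
  then show ?case
    using z Cons.IH wp_le_merge merge_in_weighted_partitions by (auto simp: labeled_cover_Wp_Wp)
qed

lemma labeled_path_Wp_Cons:
  assumes "labeled_path (labeled_cover n k) (Wp p) (t # ts) (Wp q)"
  obtains a b l where "t = (a, b, l)" "p \<in> weighted_partitions n k" "admissible n k p (a, b, l)"
    "merge_layers a b l p \<in> weighted_partitions n k"
    "labeled_path (labeled_cover n k) (Wp (merge_layers a b l p)) ts (Wp q)"
proof -
  obtain z where z: "labeled_cover n k (Wp p) t z" "labeled_path (labeled_cover n k) z ts (Wp q)"
    using assms by auto
  then obtain p' where "z = Wp p'"
    by (cases z) (auto simp: labeled_path_Top)
  then show ?thesis
    using z that merge_in_weighted_partitions by (auto simp: labeled_cover_Wp_Wp)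
qed

text \<open>The constraints refer to the start \<open>p\<close> and not to the vertex where the
  label is used. This is sound because the sets of minima only shrink along a path.\<close>

lemma labeled_path_level:
  assumes "labeled_path (labeled_cover n k) (Wp p) ts (Wp q)" "q \<in> weighted_partitions n k"
    and "(a, b, l) \<in> set ts"
  shows "level n k p q b l \<and> a \<in> mins n p l \<and> a < b \<and> wmin q l a = wmin q l b"
  using assms
proof (induction ts arbitrary: p)
  case (Cons t ts)
  from Cons.prems(1) obtain a' b' l' where t: "t = (a', b', l')" and p: "p \<in> weighted_partitions n k"
    and adm: "admissible n k p (a', b', l')"
    and p': "merge_layers a' b' l' p \<in> weighted_partitions n k"
    and path: "labeled_path (labeled_cover n k) (Wp (merge_layers a' b' l' p)) ts (Wp q)"
    by (rule labeled_path_Wp_Cons)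
  have le: "wp_le n k (merge_layers a' b' l' p) q"
    using labeled_path_wp_le[OF path p'] .
  show ?case
  proof (cases "(a, b, l) = t")
    case True
    then have "a' = a" "b' = b" "l' = l"
      using t by auto
    then show ?thesis
      using wp_le_merge_label[OF p Cons.prems(2) adm le] admissibleD(2,6)[OF p adm]
        adm_in(1)[OF p adm] by (simp add: mins_def)
  next
    case False
    have sub: "mins n (merge_layers a' b' l' p) m \<subseteq> mins n p m" if "m \<in> {1..k}" for m
      using mins_merge[OF p adm that] by auto
    have IH: "level n k (merge_layers a' b' l' p) q b l \<and> a \<in> mins n (merge_layers a' b' l' p) l \<and>
        a < b \<and> wmin q l a = wmin q l b"
    proof (rule Cons.IH[OF path Cons.prems(2)])
      show "(a, b, l) \<in> set ts"
        using False Cons.prems(3) by simp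
    qed
    then have "l \<in> {1..k}" "1 \<in> {1..k}"
      by (auto simp: level_def)
    then show ?thesis
      using IH sub unfolding level_def by blast
  qed
qed auto

text \<open>A layer-1 minimum can disappear only as the second entry of a label.\<close>

lemma labeled_path_covers_mins:
  assumes "labeled_path (labeled_cover n k) (Wp p) ts (Wp q)"
    and "b \<in> mins n p 1" "wmin q 1 b \<noteq> b"
  shows "\<exists>a l. (a, b, l) \<in> set ts"
  using assms
proof (induction ts arbitrary: p)
  case Nil
  then show ?case
    by (simp add: mins_def)
next
  case (Cons t ts)
  from Cons.prems(1) obtain a' b' l' where t: "t = (a', b', l')" and p: "p \<in> weighted_partitions n k"
    and adm: "admissible n k p (a', b', l')"
    and path: "labeled_path (labeled_cover n k) (Wp (merge_layers a' b' l' p)) ts (Wp q)"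
    by (rule labeled_path_Wp_Cons)
  show ?case
  proof (cases "b = b'")
    case False
    then have "b \<in> mins n (merge_layers a' b' l' p) 1"
      using mins_merge[OF p adm, of 1] admissibleD(4)[OF p adm] Cons.prems(2) by auto
    then show ?thesis
      using Cons.IH[OF path _ Cons.prems(3)] by auto
  qed (use t in auto)
qed

text \<open>Together with \<open>labeled_path_wp_le\<close> this identifies reachability with
  \<open>wp_le\<close>. Any level provides a first cover, and each cover uses up one layer-1
  minimum.\<close>

lemma labeled_path_of_wp_le:
  assumes "p \<in> weighted_partitions n k" "q \<in> weighted_partitions n k" "wp_le n k p q"
  shows "\<exists>ts. labeled_path (labeled_cover n k) (Wp p) ts (Wp q)"
  using assms
proof (induction "card (mins n p 1)" arbitrary: p rule: less_induct)
  case less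
  note p = less.prems(1)
  show ?case
  proof (cases "p = q")
    case True
    then have "labeled_path (labeled_cover n k) (Wp p) [] (Wp q)"
      by simp
    then show ?thesis ..
  next
    case False
    then obtain b l where lev: "level n k p q b l"
      using wp_le_ex_level less.prems by blast
    let ?t = "(wmin q l b, b, l)" and ?p' = "merge_layers (wmin q l b) b l p"
    have adm: "admissible n k p ?t" and le: "wp_le n k ?p' q"
      using level_merge_admissible[OF less.prems lev] by auto
    obtain ts where "labeled_path (labeled_cover n k) (Wp ?p') ts (Wp q)"
      using less.hyps[OF _ merge_in_weighted_partitions[OF p adm] less.prems(2) le]
        card_mins_merge[OF p adm] by auto
    then have "labeled_path (labeled_cover n k) (Wp p) (?t # ts) (Wp q)"
      using labeled_cover.merge[OF p adm] by auto
    then show ?thesis ..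
  qed
qed

section \<open>The lexicographic order on labels, reversed in the third entry\<close>

lemma label_less_iff:
  "label_less (a1, b1, l1) (a2, b2, l2) \<longleftrightarrow>
     l2 < l1 \<or> l1 = l2 \<and> (a1 < a2 \<or> a1 = a2 \<and> b1 < b2)"
  unfolding label_less_def by auto

lemma label_less_irrefl: "\<not> label_less t t"
  by (cases t) (simp add: label_less_iff)

lemma label_less_trans: "label_less s t \<Longrightarrow> label_less t u \<Longrightarrow> label_less s u"
  by (cases s, cases t, cases u) (auto simp: label_less_iff)

lemma label_less_total: "s = t \<or> label_less s t \<or> label_less t s"
  by (cases s, cases t) (auto simp: label_less_iff)

lemma finite_ex_least_label:
  assumes "finite T" "T \<noteq> {}"
  shows "\<exists>s\<in>T. \<forall>t\<in>T. s = t \<or> label_less s t"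
  using assms
proof (induction rule: finite_ne_induct)
  case (insert x F)
  from insert.IH obtain s where s: "s \<in> F" "\<forall>t\<in>F. s = t \<or> label_less s t" ..
  show ?case
  proof (cases "label_less x s")
    case True
    then have "label_less x t" if "t \<in> F" for t
      using bspec[OF s(2) that] True label_less_trans[OF True, of t] by auto
    then show ?thesis
      by simp
  next
    case False
    then have "s = x \<or> label_less s x"
      using label_less_total[of s x] by blast
    then show ?thesis
      using s by (intro bexI[of _ s]) (simp_all only: ball_simps insertI2)
  qed
qed simp

lemma least_label_Wp:
  assumes p: "p \<in> weighted_partitions n k" and q: "q \<in> weighted_partitions n k"
    and le: "wp_le n k p q" and "p \<noteq> q"
  shows "\<exists>t0 p'. labeled_cover n k (Wp p) t0 (Wp p') \<and> wp_le n k p' q \<and>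
    (\<forall>ts. labeled_path (labeled_cover n k) (Wp p) ts (Wp q) \<longrightarrow>
      (\<forall>t\<in>set ts. t0 = t \<or> label_less t0 t) \<and> t0 \<in> set ts)"
proof -
  define T where "T = {(wmin q l b, b, l) | b l. level n k p q b l}"
  have "T \<subseteq> {1..n} \<times> {1..n} \<times> {1..k}"
    using wmin_in[OF q] by (auto simp: T_def level_def mins_def)
  then have "finite T"
    by (rule finite_subset) simp
  moreover have "T \<noteq> {}"
    using wp_le_ex_level[OF p q le \<open>p \<noteq> q\<close>] by (auto simp: T_def)
  ultimately have "\<exists>s\<in>T. \<forall>t\<in>T. s = t \<or> label_less s t"
    by (rule finite_ex_least_label)
  then obtain t0 where "t0 \<in> T" and "\<forall>t\<in>T. t0 = t \<or> label_less t0 t" ..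
  note least = bspec[OF this(2)]
  from \<open>t0 \<in> T\<close> obtain b0 l0 where t0: "t0 = (wmin q l0 b0, b0, l0)" and lev0: "level n k p q b0 l0"
    by (auto simp: T_def)
  have b0: "b0 \<in> mins n p 1" "b0 \<in> {1..n}" "l0 \<in> {1..k}" "wmin q l0 b0 \<noteq> b0"
    using lev0 by (auto simp: level_def mins_def)
  note adm = level_merge_admissible[OF p q le lev0]
  have "t0 = t \<or> label_less t0 t"
    if path: "labeled_path (labeled_cover n k) (Wp p) ts (Wp q)" and t: "t \<in> set ts" for ts t
  proof -
    obtain a b l where abl: "t = (a, b, l)"
      by (cases t)
    then have lev: "level n k p q b l" and a: "a \<in> mins n p l" "wmin q l a = wmin q l b"
      using labeled_path_level[OF path q, of a b l] t by blast+
    \<comment> \<open>Replacing \<open>a\<close> by \<open>wmin q l b\<close> can only lower the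
      label, so it suffices to compare \<open>t0\<close> with the members of
      \<open>T\<close>.\<close>
    then have "wmin q l b \<le> a"
      using wmin_le[OF q, of l a] by (auto simp: mins_def level_def)
    then have "(wmin q l b, b, l) = t \<or> label_less (wmin q l b, b, l) t"
      unfolding abl label_less_iff prod.inject by presburger
    moreover have "t0 = (wmin q l b, b, l) \<or> label_less t0 (wmin q l b, b, l)"
      using lev by (intro least) (auto simp: T_def)
    ultimately show ?thesis
      using label_less_trans[of t0 "(wmin q l b, b, l)" t] by auto
  qed
  moreover have "t0 \<in> set ts" if path: "labeled_path (labeled_cover n k) (Wp p) ts (Wp q)" for ts
  proof -
    have "wmin q 1 b0 \<noteq> b0"
      using wmin_fixed_mono[OF q, of 1 b0 l0] b0 by auto
    then obtain a l where al: "(a, b0, l) \<in> set ts"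
      using labeled_path_covers_mins[OF path b0(1)] by blast
    note al_level = labeled_path_level[OF path q al]
    then have "l = l0"
      using level_unique[OF lev0] by blast
    then have a: "a \<in> mins n p l0" "a < b0" "wmin q l0 a = wmin q l0 b0"
      using al_level by blast+
    \<comment> \<open>Otherwise \<open>q\<close> moves \<open>a\<close> in layer \<open>l0\<close>,
      so \<open>a\<close> has a level \<open>l1 >= l0\<close> of its own. Its label in
      \<open>T\<close> would precede \<open>t0\<close>: either \<open>l1 > l0\<close>, or the first
      entries agree and \<open>a < b0\<close>.\<close>
    have "a = wmin q l0 b0"
    proof (rule ccontr)
      assume "a \<noteq> wmin q l0 b0"
      then have ne: "wmin q l0 a \<noteq> a"
        using a(3) by simp
      then have "a \<in> mins n p 1"
        using wp_le_fixed[OF le b0(3)] a(1) by (auto simp: mins_def)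
      then obtain l1 where l1: "l0 \<le> l1" "level n k p q a l1"
        using ex_level[OF _ b0(3) ne] by blast
      then have "(wmin q l1 a, a, l1) \<in> T"
        by (auto simp: T_def)
      then have "t0 = (wmin q l1 a, a, l1) \<or> label_less t0 (wmin q l1 a, a, l1)"
        by (rule least)
      then show False
        using l1(1) a unfolding t0 label_less_iff prod.inject by (elim disjE) auto
    qed
    then show ?thesis
      using al \<open>l = l0\<close> t0 by simp
  qed
  moreover have "labeled_cover n k (Wp p) t0 (Wp (merge_layers (wmin q l0 b0) b0 l0 p))"
    unfolding t0 by (rule labeled_cover.merge[OF p adm(1)])
  ultimately show ?thesis
    using adm(2) by blast
qed

section \<open>The grading and the top element\<close>

context
  fixes n k :: nat
  assumes n: "n \<ge> 1" and k: "k \<ge> 1"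
begin

lemma wp_rank_mins: "p \<in> weighted_partitions n k \<Longrightarrow> wp_rank n p = n - card (mins n p 1)"
  using wp_card_layer k by (simp add: wp_rank_def)

lemma card_mins_bounds:
  assumes "p \<in> weighted_partitions n k"
  shows "1 \<le> card (mins n p 1)" "card (mins n p 1) \<le> n"
proof -
  have fin: "finite (mins n p 1)" and sub: "mins n p 1 \<subseteq> {1..n}"
    by (auto simp: mins_def)
  have "1 \<in> mins n p 1"
    using one_in_mins[OF assms n] k by simp
  then show "1 \<le> card (mins n p 1)"
    using fin by (metis One_nat_def Suc_leI card_gt_0_iff empty_iff)
  show "card (mins n p 1) \<le> n"
    using card_mono[OF _ sub] by simp
qed

lemma wp_rank_eq_iff:
  assumes p: "p \<in> weighted_partitions n k"
  shows "wp_rank n p = n - 1 \<longleftrightarrow> mins n p 1 = {1}"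
proof -
  have one: "1 \<in> mins n p 1"
    using one_in_mins[OF p n] k by simp
  have "wp_rank n p = n - 1 \<longleftrightarrow> card (mins n p 1) = 1"
    using card_mins_bounds[OF p] by (auto simp: wp_rank_mins[OF p])
  also have "\<dots> \<longleftrightarrow> mins n p 1 = {1}"
    using one by (auto simp: card_1_singleton_iff)
  finally show ?thesis .
qed

lemma L_rank_labeled_cover: "labeled_cover n k x t y \<Longrightarrow> L_rank n y = L_rank n x + 1"
proof (induction rule: labeled_cover.induct)
  case (merge p a b l)
  then show ?case
    using card_mins_merge[OF merge] card_mins_bounds wp_rank_mins merge_in_weighted_partitions[OF merge]
    by (simp add: L_rank_def) (metis Suc_diff_le diff_Suc_Suc)
next
  case (top p)
  then show ?case
    using n by (simp add: L_rank_def)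
qed

lemma L_rank_labeled_path:
  "labeled_path (labeled_cover n k) x ts y \<Longrightarrow> L_rank n y = L_rank n x + length ts"
  by (induction ts arbitrary: x) (auto dest!: L_rank_labeled_cover)

lemma L_order_strict_mono:
  assumes "(x, y) \<in> L_order n k" "x \<noteq> y"
  shows "L_rank n x < L_rank n y"
proof -
  obtain ts where "labeled_path (labeled_cover n k) x ts y"
    using assms(1) by (auto simp: L_order_iff)
  moreover from this have "ts \<noteq> []"
    using assms(2) by auto
  ultimately show ?thesis
    using L_rank_labeled_path by auto
qed

lemma partial_order_L_order: "partial_order_on (L_carrier n k) (L_order n k)"
  unfolding partial_order_on_def preorder_on_def
proof (intro conjI)
  show "L_order n k \<subseteq> L_carrier n k \<times> L_carrier n k"
    by (auto simp: L_order_def)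
  show "refl_on (L_carrier n k) (L_order n k)"
    by (auto simp: refl_on_def L_order_def)
  show "trans (L_order n k)"
    by (rule transI) (auto simp: L_order_def)
  show "antisym (L_order n k)"
    by (rule antisymI) (metis L_order_strict_mono less_asym)
qed

lemma labeled_cover_L_order: "labeled_cover n k x t y \<Longrightarrow> (x, y) \<in> L_order n k"
  using labeled_cover_carrier unfolding L_order_def by blast

text \<open>The first vertex of a nontrivial path from \<open>x\<close> to \<open>y\<close> lies
  strictly above \<open>x\<close>, so it is \<open>y\<close> when nothing lies between. Conversely,
  a rank difference of one leaves no room for a further element.\<close>

lemma hasse_cover_L_order: "hasse_cover (L_order n k) x y \<longleftrightarrow> (\<exists>t. labeled_cover n k x t y)"
proof
  assume H: "hasse_cover (L_order n k) x y"
  then obtain ts where ts: "labeled_path (labeled_cover n k) x ts y" "x \<noteq> y"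
    by (auto simp: hasse_cover_def L_order_iff)
  then obtain t us z where z: "labeled_cover n k x t z" "labeled_path (labeled_cover n k) z us y"
    by (cases ts) auto
  have "(x, z) \<in> L_order n k" "(z, y) \<in> L_order n k"
    using z labeled_cover_L_order labeled_cover_carrier H
    by (auto simp: L_order_iff hasse_cover_def)
  moreover have "z \<noteq> x"
    using L_rank_labeled_cover[OF z(1)] by auto
  ultimately show "\<exists>t. labeled_cover n k x t y"
    using H z(1) unfolding hasse_cover_def by blast
next
  assume "\<exists>t. labeled_cover n k x t y"
  then obtain t where t: "labeled_cover n k x t y" ..
  have rank: "L_rank n y = L_rank n x + 1"
    using L_rank_labeled_cover[OF t] .
  have "z = x \<or> z = y" if "(x, z) \<in> L_order n k" "(z, y) \<in> L_order n k" for z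
    using L_order_strict_mono[OF that(1)] L_order_strict_mono[OF that(2)] rank by fastforce
  then show "hasse_cover (L_order n k) x y"
    using labeled_cover_L_order[OF t] rank by (auto simp: hasse_cover_def)
qed

text \<open>The label can be read off the two ends: \<open>b\<close> is the lost layer-1 minimum,
  \<open>l\<close> the last layer in which it is lost, and \<open>a\<close> its new minimum in that
  layer.\<close>

lemma labeled_cover_label_unique:
  assumes "labeled_cover n k x t y" "labeled_cover n k x t' y"
  shows "t = t'"
proof (cases x)
  case (Wp p)
  show ?thesis
  proof (cases y)
    case y: (Wp q)
    obtain a b l a' b' l' where t: "t = (a, b, l)" "t' = (a', b', l')"
      and p: "p \<in> weighted_partitions n k"
      and adm: "admissible n k p (a, b, l)" "admissible n k p (a', b', l')"
      and q: "q = merge_layers a b l p" "q = merge_layers a' b' l' p"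
      using assms unfolding Wp y labeled_cover_Wp_Wp by blast
    note ad = admissibleD[OF p adm(1)] adm_in[OF p adm(1)]
    note ad' = admissibleD[OF p adm(2)] adm_in[OF p adm(2)]
    have "mins n q 1 = mins n p 1 - {b}" "mins n q 1 = mins n p 1 - {b'}"
      using mins_merge[OF p adm(1), of 1] mins_merge[OF p adm(2), of 1] ad(4) ad'(4) q by simp_all
    then have b: "b = b'"
      using adm_mem_mins[OF p adm(1)] adm_mem_mins[OF p adm(2)] by auto
    have "b \<in> mins n q m \<longleftrightarrow> l < m" "b \<in> mins n q m \<longleftrightarrow> l' < m" if "m \<in> {1..k}" for m
      using mins_merge[OF p adm(1) that] mins_merge[OF p adm(2) that] b
        adm_fixed[OF p adm(1) that] ad(8) q
      by (auto simp: mins_def split: if_splits)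
    from this[of l] this[of l'] have l: "l = l'"
      using ad(4) ad'(4) by simp
    have "wmin q l b = a" "wmin q l' b' = a'"
      using wmin_merge[OF p adm(1), of l b] wmin_merge[OF p adm(2), of l' b'] q ad ad'
        adm_fixed[OF p adm(1), of l] adm_fixed[OF p adm(2), of l'] by auto
    then show ?thesis
      using t b l by simp
  qed (use assms Wp in \<open>auto simp: labeled_cover_Wp_Top\<close>)
qed (use assms not_labeled_cover_Top in auto)

text \<open>A merge is determined by its label, so only a clash between a merge and the edge to
  \<open>Top\<close> could arise. At rank \<open>n - 1\<close> the sole layer-1 minimum is 1, which
  leaves no admissible \<open>b > a >= 1\<close>.\<close>

lemma labeled_cover_target_unique:
  assumes "labeled_cover n k x t y" "labeled_cover n k x t y'"
  shows "y = y'"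
proof -
  have False if p: "p \<in> weighted_partitions n k" "wp_rank n p = n - 1"
    and adm: "admissible n k p (a, b, l)" for p a b l
    using that adm_mem_mins[OF p(1) adm] wp_rank_eq_iff admissibleD[OF p(1) adm] by auto
  then show ?thesis
    using assms by (auto elim!: labeled_cover.cases)
qed

lemma edge_labeling_labeled_cover: "edge_labeling (L_order n k) (labeled_cover n k)"
  using labeled_cover_label_unique by (auto simp: edge_labeling_def hasse_cover_L_order)

section \<open>The least element and paths up to the top\<close>

lemma ex_bottom:
  "\<exists>z\<in>weighted_partitions n k. wp_rank n z = 0 \<and> (\<forall>p\<in>weighted_partitions n k. wp_le n k z p)"
proof -
  let ?Q = "(\<lambda>i. {i}) ` {1..n}"
  let ?z = "replicate k ?Q"
  have part: "partition_on {1..n} ?Q"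
    by (auto simp: partition_on_def disjoint_def)
  have layer: "layer ?z m = ?Q" if "m \<in> {1..k}" for m
    using that by (auto simp: layer_def)
  have block: "block ?Q i = {i}" if "i \<in> {1..n}" for i
    using that by (intro block_eqI[OF part]) auto
  then have wmin: "wmin ?z m i = i" if "m \<in> {1..k}" "i \<in> {1..n}" for m i
    unfolding wmin_def layer[OF that(1)] bmin_def block[OF that(2)] by simp
  have z: "?z \<in> weighted_partitions n k"
    unfolding weighted_partitions_iff using part layer wmin by auto
  have "mins n ?z 1 = {1..n}"
    using wmin k by (auto simp: mins_def)
  then have "wp_rank n ?z = 0"
    using wp_rank_mins[OF z] by simp
  moreover have "wp_le n k ?z p" for p
    unfolding wp_le_def using wmin k by simp
  ultimately show ?thesis
    using z by blast
qed

text \<open>Since 1 is a block minimum in every layer, it can absorb any other layer-1 minimum, even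
  with the largest index \<open>k\<close>.\<close>

lemma admissible_one:
  assumes p: "p \<in> weighted_partitions n k" and b: "b \<in> mins n p 1 - {1}"
  shows "admissible n k p (1, b, k)"
  using one_in_mins[OF p n, of k] b k by (auto simp: admissible_iff[OF p] mins_def)

lemma labeled_path_to_Top:
  assumes "p \<in> weighted_partitions n k"
  shows "\<exists>ts. labeled_path (labeled_cover n k) (Wp p) ts Top"
  using assms
proof (induction "card (mins n p 1)" arbitrary: p rule: less_induct)
  case less
  note p = less.prems
  show ?case
  proof (cases "mins n p 1 = {1}")
    case True
    then have "labeled_path (labeled_cover n k) (Wp p) [(1, n, k)] Top"
      using p wp_rank_eq_iff by (simp add: labeled_cover_Wp_Top)
    then show ?thesis ..
  next
    case False
    then obtain b where "b \<in> mins n p 1 - {1}"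
      using one_in_mins[OF p n, of 1] k by auto
    then have adm: "admissible n k p (1, b, k)"
      by (rule admissible_one[OF p])
    obtain ts where "labeled_path (labeled_cover n k) (Wp (merge_layers 1 b k p)) ts Top"
      using less.hyps[OF _ merge_in_weighted_partitions[OF p adm]] card_mins_merge[OF p adm] by auto
    then have "labeled_path (labeled_cover n k) (Wp p) ((1, b, k) # ts) Top"
      using labeled_cover.merge[OF p adm] by auto
    then show ?thesis ..
  qed
qed

lemma graded_L: "graded_poset (L_carrier n k) (L_order n k) (L_rank n)"
  unfolding graded_poset_def
proof (intro conjI allI impI ballI)
  fix x assume x: "x \<in> L_carrier n k" and minimal: "\<forall>z. (z, x) \<in> L_order n k \<longrightarrow> z = x"
  obtain z where z: "z \<in> weighted_partitions n k" "wp_rank n z = 0"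
    and le: "\<And>p. p \<in> weighted_partitions n k \<Longrightarrow> wp_le n k z p"
    using ex_bottom by blast
  \<comment> \<open>The all-singletons element lies below everything, \<open>Top\<close> included,
    so a minimal element must equal it.\<close>
  have "(Wp z, x) \<in> L_order n k"
    using x z labeled_path_to_Top[OF z(1)] labeled_path_of_wp_le[OF z(1) _ le]
    by (auto simp: L_order_iff L_carrier_def)
  then have "x = Wp z"
    using minimal by blast
  then show "L_rank n x = 0"
    using z by (simp add: L_rank_def)
qed (use partial_order_L_order L_order_strict_mono L_rank_labeled_cover in
    \<open>auto simp: hasse_cover_L_order\<close>)

text \<open>The second entry of a merge label is a layer-1 minimum of \<open>p\<close> larger than
  1; inserting \<open>n\<close> accounts for the final edge.\<close>

lemma labeled_path_Top_labels:
  assumes "p \<in> weighted_partitions n k" "labeled_path (labeled_cover n k) (Wp p) ts Top"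
  shows "(\<forall>(a, b, l)\<in>set ts. 1 \<le> a \<and> l \<le> k \<and> b \<in> insert n (mins n p 1 - {1})) \<and>
    (\<exists>us. ts = us @ [(1, n, k)]) \<and> (\<forall>b\<in>mins n p 1 - {1}. \<exists>a l. (a, b, l) \<in> set ts)"
  using assms
proof (induction ts arbitrary: p)
  case (Cons t ts)
  then obtain z where z: "labeled_cover n k (Wp p) t z" "labeled_path (labeled_cover n k) z ts Top"
    by auto
  show ?case
  proof (cases z)
    case (Wp p')
    then obtain a b l where t: "t = (a, b, l)" and adm: "admissible n k p (a, b, l)"
      and p': "p' = merge_layers a b l p" "p' \<in> weighted_partitions n k"
      using z(1) merge_in_weighted_partitions by (auto simp: labeled_cover_Wp_Wp)
    have mins: "mins n p' 1 = mins n p 1 - {b}"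
      using mins_merge[OF Cons.prems(1) adm, of 1] admissibleD(4)[OF Cons.prems(1) adm] p' by simp
    note IH = Cons.IH[OF p'(2) z(2)[unfolded Wp]]
    obtain us where "ts = us @ [(1, n, k)]"
      using IH by blast
    then have "t # ts = (t # us) @ [(1, n, k)]"
      by simp
    moreover have "\<forall>(a, b, l)\<in>set (t # ts). 1 \<le> a \<and> l \<le> k \<and> b \<in> insert n (mins n p 1 - {1})"
      using IH mins admissibleD[OF Cons.prems(1) adm] adm_mem_mins[OF Cons.prems(1) adm]
      by (auto simp: t)
    moreover have "\<exists>a l. (a, c, l) \<in> set (t # ts)" if "c \<in> mins n p 1 - {1}" for c
      using IH mins that by (cases "c = b") (auto simp: t)
    ultimately show ?thesis
      by blast
  next
    case Top
    then have "mins n p 1 = {1}" "t = (1, n, k)" "ts = []"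
      using z wp_rank_eq_iff[OF Cons.prems(1)] by (auto simp: labeled_cover_Wp_Top labeled_path_Top)
    then show ?thesis
      by simp
  qed
qed auto

lemma
  assumes "p \<in> weighted_partitions n k" "labeled_path (labeled_cover n k) (Wp p) ts Top"
  shows labeled_path_Top_bounds:
      "(a, b, l) \<in> set ts \<Longrightarrow> 1 \<le> a \<and> l \<le> k \<and> b \<in> insert n (mins n p 1 - {1})"
    and labeled_path_Top_last: "\<exists>us. ts = us @ [(1, n, k)]"
    and labeled_path_Top_covers_mins: "b \<in> mins n p 1 - {1} \<Longrightarrow> \<exists>a l. (a, b, l) \<in> set ts"
proof -
  note labels = labeled_path_Top_labels[OF assms]
  show "\<exists>us. ts = us @ [(1, n, k)]"
    by (rule conjunct1[OF conjunct2[OF labels]])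
  show "\<exists>a l. (a, b, l) \<in> set ts" if "b \<in> mins n p 1 - {1}"
    by (rule bspec[OF conjunct2[OF conjunct2[OF labels]] that])
  show "1 \<le> a \<and> l \<le> k \<and> b \<in> insert n (mins n p 1 - {1})" if "(a, b, l) \<in> set ts"
    using bspec[OF conjunct1[OF labels] that] by simp
qed

text \<open>Below \<open>Top\<close> the levels are not prescribed, so a path may avoid
  \<open>t0\<close>. Membership is therefore claimed for rising paths only, where the final label
  \<open>(1, n, k)\<close> bounds all others from above.\<close>

lemma least_label_Top:
  assumes p: "p \<in> weighted_partitions n k"
  shows "\<exists>t0 z. labeled_cover n k (Wp p) t0 z \<and> (z, Top) \<in> L_order n k \<and>
    (\<forall>ts. labeled_path (labeled_cover n k) (Wp p) ts Top \<longrightarrow>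
      (\<forall>t\<in>set ts. t0 = t \<or> label_less t0 t) \<and>
      (successively (\<lambda>s t. s = t \<or> label_less s t) ts \<longrightarrow> t0 \<in> set ts))"
proof (cases "mins n p 1 = {1}")
  case True
  have "labeled_cover n k (Wp p) (1, n, k) Top"
    using True p wp_rank_eq_iff by (simp add: labeled_cover_Wp_Top)
  moreover have "(Top, Top) \<in> L_order n k"
    by (simp add: L_order_def L_carrier_def)
  moreover have "(\<forall>t\<in>set ts. (1, n, k) = t \<or> label_less (1, n, k) t) \<and> (1, n, k) \<in> set ts"
    if path: "labeled_path (labeled_cover n k) (Wp p) ts Top" for ts
  proof -
    obtain us where "ts = us @ [(1, n, k)]"
      using labeled_path_Top_last[OF p path] ..
    then have "(1, n, k) \<in> set ts"
      by simp
    moreover have "(1, n, k) = (a, b, l) \<or> label_less (1, n, k) (a, b, l)"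
      if "(a, b, l) \<in> set ts" for a b l
    proof -
      have "1 \<le> a" "l \<le> k" "b = n"
        using labeled_path_Top_bounds[OF p path that] True by auto
      then show ?thesis
        unfolding label_less_iff prod.inject by presburger
    qed
    ultimately show ?thesis
      by (metis prod_cases3)
  qed
  ultimately show ?thesis
    by blast
next
  case False
  define b0 where "b0 = Min (mins n p 1 - {1})"
  have fin: "finite (mins n p 1 - {1})" and ne: "mins n p 1 - {1} \<noteq> {}"
    using False one_in_mins[OF p n, of 1] k by (auto simp: mins_def)
  have b0: "b0 \<in> mins n p 1 - {1}"
    unfolding b0_def by (rule Min_in[OF fin ne])
  then have "b0 \<le> n"
    by (auto simp: mins_def)
  \<comment> \<open>The bound by \<open>n\<close> ensures that the final label
    \<open>(1, n, k)\<close> is not below \<open>(1, b0, k)\<close> either.\<close>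
  have b0_le: "b0 \<le> b" if "b \<in> insert n (mins n p 1 - {1})" for b
    using that \<open>b0 \<le> n\<close> Min_le[OF fin] unfolding b0_def by blast
  have adm: "admissible n k p (1, b0, k)"
    by (rule admissible_one[OF p b0])
  let ?p' = "merge_layers 1 b0 k p"
  have p': "?p' \<in> weighted_partitions n k"
    by (rule merge_in_weighted_partitions[OF p adm])
  have "labeled_cover n k (Wp p) (1, b0, k) (Wp ?p')"
    by (rule labeled_cover.merge[OF p adm])
  moreover have "(Wp ?p', Top) \<in> L_order n k"
    using p' labeled_path_to_Top by (auto simp: L_order_iff L_carrier_def)
  moreover have "(1, b0, k) = t \<or> label_less (1, b0, k) t"
    if path: "labeled_path (labeled_cover n k) (Wp p) ts Top" and t: "t \<in> set ts" for ts t
  proof -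
    obtain a b l where abl: "t = (a, b, l)"
      by (cases t)
    then have "(a, b, l) \<in> set ts"
      using t by simp
    from labeled_path_Top_bounds[OF p path this] have "1 \<le> a" "l \<le> k" "b0 \<le> b"
      using b0_le[of b] by blast+
    then show ?thesis
      unfolding abl label_less_iff prod.inject by presburger
  qed
  moreover have "(1, b0, k) \<in> set ts"
    if path: "labeled_path (labeled_cover n k) (Wp p) ts Top"
      and rise: "successively (\<lambda>s t. s = t \<or> label_less s t) ts" for ts
  proof -
    obtain us where us: "ts = us @ [(1, n, k)]"
      using labeled_path_Top_last[OF p path] ..
    obtain a l where al: "(a, b0, l) \<in> set ts"
      using labeled_path_Top_covers_mins[OF p path b0] by (elim exE)
    note al = al labeled_path_Top_bounds[OF p path al]
    have "transp (\<lambda>s t. s = t \<or> label_less s t)"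
      by (rule transpI) (metis label_less_trans)
    then have "sorted_wrt (\<lambda>s t. s = t \<or> label_less s t) ts"
      using rise by (simp add: successively_conv_sorted_wrt)
    \<comment> \<open>Comparison with the last label forces \<open>l >= k\<close> and, given
      \<open>l <= k\<close>, also \<open>a <= 1\<close>; with \<open>1 <= a\<close> the label is
      \<open>(1, b0, k)\<close>.\<close>
    then have "(a, b0, l) = (1, n, k) \<or> label_less (a, b0, l) (1, n, k)"
      using al(1) us by (simp add: sorted_wrt_append) blast
    then have "a = 1" "l = k"
      using al unfolding label_less_iff prod.inject by linarith+
    then show ?thesis
      using al by simp
  qed
  ultimately show ?thesis
    by blast
qed

end

theorem mainTheorem3:
  fixes n k :: nat
  assumes "n \<ge> 1" and "k \<ge> 1"
  shows "EL_labeling (L_carrier n k) (L_order n k) (L_rank n) label_less (labeled_cover n k)"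
proof (rule EL_labelingI[OF graded_L[OF assms] edge_labeling_labeled_cover[OF assms]
      labeled_cover_target_unique[OF assms] label_less_irrefl label_less_trans])
  fix x y assume xy: "(x, y) \<in> L_order n k" "x \<noteq> y"
  then obtain ts where path: "labeled_path (labeled_cover n k) x ts y"
    and carrier: "x \<in> L_carrier n k" "y \<in> L_carrier n k"
    by (auto simp: L_order_iff)
  \<comment> \<open>Only the trivial path starts at \<open>Top\<close>, and \<open>x\<close> differs
    from \<open>y\<close>.\<close>
  obtain p where x: "x = Wp p"
    using path xy(2) by (cases x) (auto simp: labeled_path_Top)
  then have p: "p \<in> weighted_partitions n k"
    using carrier by (simp add: Wp_in_L_carrier)
  show "\<exists>t0 z. labeled_cover n k x t0 z \<and> (z, y) \<in> L_order n k \<and>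
      (\<forall>ts. labeled_path (labeled_cover n k) x ts y \<longrightarrow>
        (\<forall>t\<in>set ts. t0 = t \<or> label_less t0 t) \<and>
        (successively (\<lambda>s t. s = t \<or> label_less s t) ts \<longrightarrow> t0 \<in> set ts))"
  proof (cases y)
    case (Wp q)
    then have q: "q \<in> weighted_partitions n k"
      using carrier by (simp add: Wp_in_L_carrier)
    have "wp_le n k p q" "p \<noteq> q"
      using path labeled_path_wp_le p x Wp xy(2) by auto
    then obtain t0 p' where t0: "labeled_cover n k (Wp p) t0 (Wp p')" "wp_le n k p' q"
      "\<And>ts. labeled_path (labeled_cover n k) (Wp p) ts (Wp q) \<Longrightarrow>
        (\<forall>t\<in>set ts. t0 = t \<or> label_less t0 t) \<and> t0 \<in> set ts"
      using least_label_Wp[OF p q] by blast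
    have p': "p' \<in> weighted_partitions n k"
      using labeled_cover_carrier[OF t0(1)] by (simp add: Wp_in_L_carrier)
    then have "(Wp p', Wp q) \<in> L_order n k"
      using labeled_path_of_wp_le[OF p' q t0(2)] q by (simp add: L_order_iff Wp_in_L_carrier)
    then show ?thesis
      using t0 unfolding x Wp by blast
  next
    case Top
    then show ?thesis
      using least_label_Top[OF assms p] unfolding x Top by blast
  qed
qed

end
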